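(* For every dimension $n\geq 1$, the inverse diameter process of the convex hull of standard Brownian motion in $\mathbb{R}^n$ satisfies \[ \frac{1}{4\log 2}\,\frac{1}{n}\;\leq\;\mathbb{E}\left[\Theta_1^D\right]\;\leq\; \frac{1}{n}. \]
   Context: Let $\boldsymbol{W}=\{\boldsymbol{W}_t:t\geq 0\}$ be standard Brownian motion in $\mathbb{R}^n$ started at the origin, i.e. $\boldsymbol{W}_t=(W_t^{(1)},\dots,W_t^{(n)})$ where the coordinates are independent standard one-dimensional Brownian motions. Let $\mathcal{H}_t:=\operatorname{conv}\{\boldsymbol{W}_s:0\leq s\leq t\}$ be the convex hull of the path up to time $t$ (almost surely a nonempty compact convex set). Let $D_t:=D(\mathcal{H}_t)$, where $D(\mathcal{K})$ denotes the Euclidean diameter of $\mathcal{K}$. The inverse diameter process is $\Theta_y^D:=\inf\{t\geq 0: D_t>y\}$ for $y\geq 0$. $\log$ is the natural logarithm. *)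

theory Defs
  imports "HOL-Probability.Probability"
begin

definition std_brownian_motion_1d :: "'w measure \<Rightarrow> (real \<Rightarrow> 'w \<Rightarrow> real) \<Rightarrow> bool" where
  "std_brownian_motion_1d M B \<longleftrightarrow>
     prob_space M \<and>
     (\<forall>t\<ge>0. B t \<in> borel_measurable M) \<and>
     (AE \<omega> in M. B 0 \<omega> = 0) \<and>
     (\<forall>(t :: nat \<Rightarrow> real) k. 0 \<le> t 0 \<longrightarrow> strict_mono_on {..k} t \<longrightarrow>
        prob_space.indep_vars M (\<lambda>_. borel) (\<lambda>i \<omega>. B (t (Suc i)) \<omega> - B (t i) \<omega>) {..<k}) \<and>
     (\<forall>s t. 0 \<le> s \<longrightarrow> s < t \<longrightarrow>
        distributed M lborel (\<lambda>\<omega>. B t \<omega> - B s \<omega>) (normal_density 0 (sqrt (t - s)))) \<and>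
     (AE \<omega> in M. continuous_on {0..} (\<lambda>t. B t \<omega>))"

text \<open>Independence of the coordinates is independence of whole processes: each coordinate
  is viewed as a random element of the product space of all functions on \<open>{0..}\<close>.\<close>

definition std_brownian_motion ::
    "'w measure \<Rightarrow> (real \<Rightarrow> 'w \<Rightarrow> real ^ 'n) \<Rightarrow> bool" where
  "std_brownian_motion M W \<longleftrightarrow>
     (\<forall>i. std_brownian_motion_1d M (\<lambda>t \<omega>. W t \<omega> $ i)) \<and>
     prob_space.indep_vars M (\<lambda>_. PiM {0..} (\<lambda>_. borel))
       (\<lambda>i \<omega>. \<lambda>t\<in>{0..}. W t \<omega> $ i) UNIV"

definition path_hull :: "(real \<Rightarrow> 'w \<Rightarrow> real ^ 'n) \<Rightarrow> real \<Rightarrow> 'w \<Rightarrow> (real ^ 'n) set" where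
  "path_hull W t \<omega> = convex hull ((\<lambda>s. W s \<omega>) ` {0..t})"

text \<open>The infimum is taken in \<^typ>\<open>ennreal\<close>, so it is \<open>\<infinity>\<close> when the level \<open>y\<close> is never exceeded.
  Outside the null set of discontinuous paths this is a measurable function of \<open>\<omega>\<close>,
  so \<^const>\<open>nn_integral\<close> gives its expectation.\<close>

definition inverse_diameter ::
    "(real \<Rightarrow> 'w \<Rightarrow> real ^ 'n) \<Rightarrow> real \<Rightarrow> 'w \<Rightarrow> ennreal" where
  "inverse_diameter W y \<omega> = Inf {ennreal t | t. 0 \<le> t \<and> diameter (path_hull W t \<omega>) > y}"

end

theory Submission
  imports Defs "HOL-Real_Asymp.Real_Asymp"
begin

text \<open>Upper bound. The hull contains \<open>W 0\<close> and \<open>W t\<close>, so \<open>\<Theta>\<close> is at most the exit time \<open>\<tau>\<close> of the unit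
  ball around the starting point, and since \<open>|W t|\<^sup>2 - n t\<close> is a martingale, \<open>E \<tau> = 1 / n\<close>. On a grid
  of mesh \<open>d\<close> the walk overshoots the sphere; \<open>ball_exit_mean_step\<close> pays for that with a fourth moment, which
  is \<open>O(d\<^sup>2)\<close> per step against the gain \<open>n d\<close> and hence disappears as \<open>d\<close> tends to \<open>0\<close>.

  Lower bound. By Brownian scaling \<open>D t\<close> has the law of \<open>sqrt t * D 1\<close>, so
  \<open>E \<Theta> = \<integral> P(D t \<le> 1) dt = E (1 / (D 1)\<^sup>2) \<ge> 1 / E ((D 1)\<^sup>2)\<close>. The squared diameter is at most
  the sum of the squared ranges of the \<open>n\<close> coordinates, and the range of a one-dimensional Brownian motion over
  the unit interval has second moment \<open>4 ln 2\<close>.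

  The second moment of the range. Let \<open>X\<close> be the distance of the path below its running maximum and \<open>Y\<close> its
  distance above its running minimum, so that \<open>X + Y\<close> is the range. In continuous time
  \<open>exp (- 2 t) * (cosh (2 X) + cosh (2 Y)) / 2\<close> is a martingale that starts at \<open>1\<close>. When the range first reaches
  \<open>r\<close>, one of \<open>X\<close>, \<open>Y\<close> is \<open>0\<close> and the other is \<open>r\<close>, so the Laplace transform at \<open>2\<close> of that time
  is \<open>1 / (cosh r)\<^sup>2\<close>. Integrating against \<open>2 r dr\<close> gives \<open>2 ln 2\<close> for the mean squared range at an
  independent exponential time of mean \<open>1 / 2\<close>, and scaling turns this into \<open>4 ln 2\<close> at time \<open>1\<close>.
  For a Gaussian walk the two martingales become supermartingales without any error term, because
  \<open>cosh (max y 0) \<le> cosh y\<close>, and an overshoot of the level \<open>r\<close> works in the right direction; so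
  the bound holds exactly on every grid (\<open>discounted_range_sum_le\<close>). Superlinearity of the mean squared range
  in the number of steps (\<open>mean_sq_range_superlinear\<close>) replaces the scaling identity
  (\<open>mean_sq_range_le\<close>).

  All probabilistic statements concern finitely many times: the increments over a grid are
  independent standard Gaussian vectors whatever the mesh (\<open>distr_vector_grid_increments\<close>), which is at the same time the
  scaling property and the Markov property that are needed. Continuity of the paths enters only when the
  diameter of the hull is recovered from dyadic grids.\<close>

section \<open>Gaussian increments of Brownian motion on a grid\<close>

text \<open>Dividing by the standard deviation of an increment makes the law of the whole family independent of the mesh \<open>t\<close>.
  Restricting to \<open>{..<N}\<close> makes the family an element of the product space over that index set.\<close>
definition grid_increments ::
    "(real \<Rightarrow> 'w \<Rightarrow> 'a::real_normed_vector) \<Rightarrow> real \<Rightarrow> nat \<Rightarrow> 'w \<Rightarrow> nat \<Rightarrow> 'a" where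
  "grid_increments B t N \<omega> =
     (\<lambda>j\<in>{..<N}. (B (real (Suc j) * t) \<omega> - B (real j * t) \<omega>) /\<^sub>R sqrt t)"

definition std_gaussian_vec :: "(real ^ 'n) measure" where
  "std_gaussian_vec = distr (PiM UNIV (\<lambda>_. std_normal_distribution)) borel (\<lambda>x. \<chi> i. x i)"

lemma prob_space_std_normal [simp, intro]: "prob_space std_normal_distribution"
  by (rule prob_space_normal_density) simp

lemma std_gaussian_vec_component [measurable]:
  "(\<lambda>x. \<chi> i. x i) \<in> borel_measurable (PiM UNIV (\<lambda>_::'n::finite. borel :: real measure))"
proof (rule borel_measurable_euclidean_space[THEN iffD2], rule ballI)
  fix b :: "real ^ 'n" assume "b \<in> Basis"
  then obtain i where "b = axis i 1" by (auto simp: Basis_vec_def)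
  then show "(\<lambda>x. (\<chi> i. x i) \<bullet> b) \<in> borel_measurable (PiM UNIV (\<lambda>_::'n. borel))"
    by (simp add: inner_axis)
qed

lemma measurable_vec_lambda_PiM [measurable]:
  "(\<lambda>x. \<chi> i. x i) \<in> PiM UNIV (\<lambda>_::'n::finite. std_normal_distribution) \<rightarrow>\<^sub>M borel"
proof -
  have "sets (PiM UNIV (\<lambda>_::'n. std_normal_distribution)) = sets (PiM UNIV (\<lambda>_::'n. borel))"
    by (intro sets_PiM_cong) auto
  then show ?thesis
    using std_gaussian_vec_component measurable_cong_sets by blast
qed

lemma sets_std_gaussian_vec [simp, measurable_cong]: "sets std_gaussian_vec = sets borel"
  by (simp add: std_gaussian_vec_def)

lemma prob_space_std_gaussian_vec [simp, intro]: "prob_space std_gaussian_vec"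
  unfolding std_gaussian_vec_def
  by (intro prob_space.prob_space_distr prob_space_PiM measurable_vec_lambda_PiM) auto

context
  fixes M :: "'w measure" and B :: "real \<Rightarrow> 'w \<Rightarrow> real"
  assumes BM: "std_brownian_motion_1d M B"
begin

interpretation prob_space M
  using BM by (simp add: std_brownian_motion_1d_def)

lemma std_brownian_motion_1d_measurable:
  "0 \<le> t \<Longrightarrow> B t \<in> borel_measurable M"
  using BM by (auto simp: std_brownian_motion_1d_def)

lemma distr_scaled_increment:
  assumes t: "0 < t"
  shows "distr M borel (\<lambda>\<omega>. (B (real (Suc j) * t) \<omega> - B (real j * t) \<omega>) /\<^sub>R sqrt t)
    = std_normal_distribution"
proof -
  have d: "distributed M lborel (\<lambda>\<omega>. B (real (Suc j) * t) \<omega> - B (real j * t) \<omega>)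
     (normal_density 0 (sqrt (real (Suc j) * t - real j * t)))"
  proof -
    have "0 \<le> real j * t" "real j * t < real (Suc j) * t"
      using t by auto
    then show ?thesis
      using BM unfolding std_brownian_motion_1d_def by fast
  qed
  have e: "real (Suc j) * t - real j * t = t"
    by (simp add: algebra_simps)
  have "distributed M lborel (\<lambda>\<omega>. 0 + (1 / sqrt t) * (B (real (Suc j) * t) \<omega> - B (real j * t) \<omega>))
     (normal_density (0 + (1 / sqrt t) * 0) (\<bar>1 / sqrt t\<bar> * sqrt t))"
    using d t unfolding e by (intro normal_density_affine) auto
  then have d': "distributed M lborel (\<lambda>\<omega>. (B (real (Suc j) * t) \<omega> - B (real j * t) \<omega>) /\<^sub>R sqrt t)
     std_normal_density"
    using t by (simp add: divide_inverse mult.commute)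
  have "distr M borel (\<lambda>\<omega>. (B (real (Suc j) * t) \<omega> - B (real j * t) \<omega>) /\<^sub>R sqrt t)
    = distr M lborel (\<lambda>\<omega>. (B (real (Suc j) * t) \<omega> - B (real j * t) \<omega>) /\<^sub>R sqrt t)"
    by (rule distr_cong) auto
  then show ?thesis
    using distributed_distr_eq_density[OF d'] by simp
qed

lemma distr_grid_increments:
  assumes t: "0 < t" and N: "0 < N"
  shows "distr M (PiM {..<N} (\<lambda>_. borel)) (grid_increments B t N)
    = PiM {..<N} (\<lambda>_. std_normal_distribution)"
proof -
  have ind: "indep_vars (\<lambda>_. borel) (\<lambda>j \<omega>. B (real (Suc j) * t) \<omega> - B (real j * t) \<omega>) {..<N}"
  proof -
    have "strict_mono_on {..N} (\<lambda>j. real j * t)"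
      using t by (auto simp: strict_mono_on_def)
    note mono = this
    have "\<forall>(s :: nat \<Rightarrow> real) k. 0 \<le> s 0 \<longrightarrow> strict_mono_on {..k} s \<longrightarrow>
        indep_vars (\<lambda>_. borel) (\<lambda>i \<omega>. B (s (Suc i)) \<omega> - B (s i) \<omega>) {..<k}"
      using BM by (simp add: std_brownian_motion_1d_def)
    from this[THEN spec, of "\<lambda>j. real j * t", THEN spec, of N]
    show ?thesis using mono by simp
  qed
  have ind2: "indep_vars (\<lambda>_. borel) (\<lambda>j \<omega>. (B (real (Suc j) * t) \<omega> - B (real j * t) \<omega>) /\<^sub>R sqrt t) {..<N}"
    using indep_vars_compose2[OF ind, where Y="\<lambda>_ x. x /\<^sub>R sqrt t" and N="\<lambda>_. borel"] by simp
  have "distr M (PiM {..<N} (\<lambda>_. borel)) (grid_increments B t N)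
    = PiM {..<N} (\<lambda>j. distr M borel (\<lambda>\<omega>. (B (real (Suc j) * t) \<omega> - B (real j * t) \<omega>) /\<^sub>R sqrt t))"
    unfolding grid_increments_def using N
    by (intro indep_vars_iff_distr_eq_PiM'[THEN iffD1, OF _ _ ind2])
      (use ind2 in \<open>auto simp: indep_vars_def lessThan_empty_iff\<close>)
  then show ?thesis
    unfolding distr_scaled_increment[OF t] .
qed

end

context
  fixes M :: "'w measure" and W :: "real \<Rightarrow> 'w \<Rightarrow> real ^ 'n"
  assumes BM: "std_brownian_motion M W"
begin

interpretation prob_space M
  using BM by (simp add: std_brownian_motion_def std_brownian_motion_1d_def)

lemma coordinate_brownian_motion: "std_brownian_motion_1d M (\<lambda>t \<omega>. W t \<omega> $ i)"
  using BM by (simp add: std_brownian_motion_def)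

lemma std_brownian_motion_measurable:
  assumes "0 \<le> t" shows "W t \<in> borel_measurable M"
proof (rule borel_measurable_euclidean_space[THEN iffD2], rule ballI)
  fix b :: "real ^ 'n" assume "b \<in> Basis"
  then obtain i where "b = axis i 1" by (auto simp: Basis_vec_def)
  then show "(\<lambda>x. W t x \<bullet> b) \<in> borel_measurable M"
    using std_brownian_motion_1d_measurable[OF coordinate_brownian_motion assms]
    by (simp add: inner_axis)
qed

lemma indep_vars_coordinate_grid_increments:
  assumes t: "0 < t"
  shows "indep_vars (\<lambda>_. PiM {..<N} (\<lambda>_. borel))
    (\<lambda>i. grid_increments (\<lambda>t \<omega>. W t \<omega> $ i) t N) UNIV"
proof -
  have ind: "indep_vars (\<lambda>_. PiM {0..} (\<lambda>_. borel)) (\<lambda>i \<omega>. \<lambda>t\<in>{0..}. W t \<omega> $ i) UNIV"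
    using BM by (simp add: std_brownian_motion_def)
  have [measurable]: "(\<lambda>f. f (real j * t)) \<in> borel_measurable (PiM {0..} (\<lambda>_. borel :: real measure))" for j
    using t by (intro measurable_component_singleton) auto
  have "indep_vars (\<lambda>_. PiM {..<N} (\<lambda>_. borel))
    (\<lambda>i \<omega>. (\<lambda>f. \<lambda>j\<in>{..<N}. (f (real (Suc j) * t) - f (real j * t)) /\<^sub>R sqrt t)
        (\<lambda>t\<in>{0..}. W t \<omega> $ i)) UNIV"
    by (rule indep_vars_compose2[OF ind]) (intro measurable_restrict; measurable)
  moreover have "(\<lambda>f. \<lambda>j\<in>{..<N}. (f (real (Suc j) * t) - f (real j * t)) /\<^sub>R sqrt t)
        (\<lambda>t\<in>{0..}. W t \<omega> $ i) = grid_increments (\<lambda>t \<omega>. W t \<omega> $ i) t N \<omega>" for i \<omega>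
    using t by (auto simp: grid_increments_def fun_eq_iff)
  ultimately show ?thesis by simp
qed

lemma grid_increments_component:
  "grid_increments (\<lambda>t \<omega>. W t \<omega> $ i) t N \<omega> j = (if j < N then grid_increments W t N \<omega> j $ i else undefined)"
  by (simp add: grid_increments_def)

text \<open>The definition of a Brownian vector gives independence in two layers: between whole coordinate processes, and between
  the increments of each coordinate. A product of products is a product over pairs, so comparing
  both laws on boxes merges the two layers into one independent family, which can then be regrouped by time.\<close>
lemma indep_vars_flat_increments:
  assumes t: "0 < t" and N: "0 < N"
  shows "indep_vars (\<lambda>_. borel) (\<lambda>p \<omega>. grid_increments (\<lambda>t \<omega>. W t \<omega> $ fst p) t N \<omega> (snd p))
    (UNIV \<times> {..<N})"
proof -
  let ?X = "\<lambda>i. grid_increments (\<lambda>t \<omega>. W t \<omega> $ i) t N"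
  let ?Y = "\<lambda>p \<omega>. ?X (fst p) \<omega> (snd p)"
  let ?I = "(UNIV::'n set) \<times> {..<N}"
  note ind = indep_vars_coordinate_grid_increments[OF t, of N]
  have rv [measurable]: "?X i \<in> M \<rightarrow>\<^sub>M PiM {..<N} (\<lambda>_. borel)" for i
    using ind by (auto simp: indep_vars_def)
  have rvY [measurable]: "p \<in> ?I \<Longrightarrow> ?Y p \<in> borel_measurable M" for p
    by (auto intro!: measurable_compose[OF rv] measurable_component_singleton)
  have law: "distr M borel (?Y p) = std_normal_distribution" if "p \<in> ?I" for p
  proof -
    have "distr M borel (?Y p) = distr (distr M (PiM {..<N} (\<lambda>_. borel)) (?X (fst p))) borel (\<lambda>x. x (snd p))"
      using that by (subst distr_distr) (auto simp: comp_def)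
    also have "\<dots> = distr (PiM {..<N} (\<lambda>_. std_normal_distribution)) std_normal_distribution (\<lambda>x. x (snd p))"
      unfolding distr_grid_increments[OF coordinate_brownian_motion t N] by (rule distr_cong) auto
    also have "\<dots> = std_normal_distribution"
      using that by (intro distr_PiM_component) auto
    finally show ?thesis .
  qed
  have "distr M (PiM ?I (\<lambda>_. borel)) (\<lambda>\<omega>. \<lambda>p\<in>?I. ?Y p \<omega>) = PiM ?I (\<lambda>_. std_normal_distribution)"
  proof (rule product_sigma_finite.PiM_eqI)
    show "product_sigma_finite (\<lambda>_::'n \<times> nat. std_normal_distribution)"
      by (intro product_sigma_finite.intro prob_space_imp_sigma_finite) auto
    show "finite ?I" by simp
    show "sets (distr M (PiM ?I (\<lambda>_. borel)) (\<lambda>\<omega>. \<lambda>p\<in>?I. ?Y p \<omega>))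
        = sets (PiM ?I (\<lambda>_. std_normal_distribution))"
      by (simp, intro sets_PiM_cong) auto
  next
    fix A assume "\<And>p. p \<in> ?I \<Longrightarrow> A p \<in> sets std_normal_distribution"
    then have A [measurable]: "p \<in> ?I \<Longrightarrow> A p \<in> sets borel" for p by auto
    let ?E = "\<lambda>i. Pi\<^sub>E {..<N} (\<lambda>j. A (i, j))"
    have E: "?E i \<in> sets (PiM {..<N} (\<lambda>_. borel))" for i
      by (intro sets_PiM_I_finite) auto
    have "emeasure (distr M (PiM ?I (\<lambda>_. borel)) (\<lambda>\<omega>. \<lambda>p\<in>?I. ?Y p \<omega>)) (Pi\<^sub>E ?I A)
      = emeasure M ((\<lambda>\<omega>. \<lambda>p\<in>?I. ?Y p \<omega>) -` Pi\<^sub>E ?I A \<inter> space M)"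
      by (intro emeasure_distr measurable_restrict sets_PiM_I_finite) auto
    also have "(\<lambda>\<omega>. \<lambda>p\<in>?I. ?Y p \<omega>) -` Pi\<^sub>E ?I A \<inter> space M = (\<Inter>i\<in>UNIV. ?X i -` ?E i \<inter> space M)"
      by (auto simp: grid_increments_def PiE_iff)
    also have "emeasure M \<dots> = ennreal (\<Prod>i\<in>UNIV. prob (?X i -` ?E i \<inter> space M))"
      unfolding emeasure_eq_measure
      using indep_varsD_finite[OF ind, of ?E] E by simp
    also have "\<dots> = (\<Prod>i\<in>UNIV. emeasure M (?X i -` ?E i \<inter> space M))"
      by (simp add: emeasure_eq_measure prod_ennreal)
    also have "\<dots> = (\<Prod>i\<in>UNIV. emeasure (distr M (PiM {..<N} (\<lambda>_. borel)) (?X i)) (?E i))"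
      using E by (intro prod.cong refl emeasure_distr[symmetric]) auto
    also have "\<dots> = (\<Prod>i\<in>UNIV. \<Prod>j<N. emeasure std_normal_distribution (A (i, j)))"
      unfolding distr_grid_increments[OF coordinate_brownian_motion t N]
      by (intro prod.cong refl product_sigma_finite.emeasure_PiM product_sigma_finite.intro
          prob_space_imp_sigma_finite) auto
    also have "\<dots> = (\<Prod>p\<in>?I. emeasure std_normal_distribution (A p))"
      by (simp add: prod.cartesian_product)
    finally show "emeasure (distr M (PiM ?I (\<lambda>_. borel)) (\<lambda>\<omega>. \<lambda>p\<in>?I. ?Y p \<omega>)) (Pi\<^sub>E ?I A)
      = (\<Prod>p\<in>?I. emeasure std_normal_distribution (A p))" .
  qed
  also have "\<dots> = PiM ?I (\<lambda>p. distr M borel (?Y p))"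
    using law by (intro PiM_cong) auto
  finally show ?thesis
    using N rvY by (subst indep_vars_iff_distr_eq_PiM') (auto simp: lessThan_empty_iff)
qed

lemma distr_vector_increment:
  assumes t: "0 < t" and j: "j < N"
  shows "distr M borel (\<lambda>\<omega>. grid_increments W t N \<omega> j) = std_gaussian_vec"
proof -
  let ?X = "\<lambda>i. grid_increments (\<lambda>t \<omega>. W t \<omega> $ i) t N"
  have ind: "indep_vars (\<lambda>_. borel) (\<lambda>i \<omega>. ?X i \<omega> j) UNIV"
    using j by (intro indep_vars_compose2[OF indep_vars_coordinate_grid_increments[OF t, of N], where Y="\<lambda>_ x. x j"])
      auto
  then have rv [measurable]: "(\<lambda>\<omega>. ?X i \<omega> j) \<in> borel_measurable M" for i
    by (auto simp: indep_vars_def)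
  have law: "distr M borel (\<lambda>\<omega>. ?X i \<omega> j) = std_normal_distribution" for i
    using distr_scaled_increment[OF coordinate_brownian_motion t] j by (simp add: grid_increments_def)
  have "distr M (PiM UNIV (\<lambda>_. borel)) (\<lambda>\<omega> i. ?X i \<omega> j) = PiM UNIV (\<lambda>_. std_normal_distribution)"
    using indep_vars_iff_distr_eq_PiM[THEN iffD1, OF _ _ ind] law by (simp add: restrict_UNIV)
  then have "std_gaussian_vec = distr (distr M (PiM UNIV (\<lambda>_. borel)) (\<lambda>\<omega> i. ?X i \<omega> j)) borel (\<lambda>x. \<chi> i. x i)"
    by (simp add: std_gaussian_vec_def)
  also have "\<dots> = distr M borel ((\<lambda>x. \<chi> i. x i) \<circ> (\<lambda>\<omega> i. ?X i \<omega> j))"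
    by (rule distr_distr) (auto intro!: measurable_PiM_single' simp: std_gaussian_vec_component)
  also have "(\<lambda>x. \<chi> i. x i) \<circ> (\<lambda>\<omega> i. ?X i \<omega> j) = (\<lambda>\<omega>. grid_increments W t N \<omega> j)"
    using j by (auto simp: fun_eq_iff grid_increments_component vec_eq_iff)
  finally show ?thesis ..
qed

text \<open>The right-hand side does not contain \<open>t\<close>, so functionals of the path on grids of different mesh can be compared; the product
  form lets one step of the walk be integrated at a time.\<close>
lemma distr_vector_grid_increments:
  assumes t: "0 < t" and N: "0 < N"
  shows "distr M (PiM {..<N} (\<lambda>_. borel)) (grid_increments W t N)
    = PiM {..<N} (\<lambda>_. std_gaussian_vec)"
proof -
  let ?X = "\<lambda>i. grid_increments (\<lambda>t \<omega>. W t \<omega> $ i) t N"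
  let ?Y = "\<lambda>p \<omega>. ?X (fst p) \<omega> (snd p)"
  let ?K = "\<lambda>j::nat. (UNIV::'n set) \<times> {j}"
  have "indep_vars (\<lambda>j. PiM (?K j) (\<lambda>_. borel)) (\<lambda>j \<omega>. restrict (\<lambda>p. ?Y p \<omega>) (?K j)) {..<N}"
    by (rule indep_vars_restrict[OF indep_vars_flat_increments[OF t N]])
      (auto simp: disjoint_family_on_def)
  then have "indep_vars (\<lambda>_. borel)
      (\<lambda>j \<omega>. (\<lambda>x. \<chi> i. x (i, j)) (restrict (\<lambda>p. ?Y p \<omega>) (?K j))) {..<N}"
  proof (rule indep_vars_compose2)
    fix j
    have "(\<lambda>x i. x (i, j)) \<in> PiM (?K j) (\<lambda>_. borel) \<rightarrow>\<^sub>M PiM UNIV (\<lambda>_::'n. borel :: real measure)"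
      by (auto intro!: measurable_PiM_single')
    from measurable_compose[OF this std_gaussian_vec_component]
    show "(\<lambda>x. \<chi> i. x (i, j)) \<in> PiM (?K j) (\<lambda>_. borel) \<rightarrow>\<^sub>M (borel :: (real^'n) measure)"
      by simp
  qed
  also have "?this \<longleftrightarrow> indep_vars (\<lambda>_. borel) (\<lambda>j \<omega>. grid_increments W t N \<omega> j) {..<N}"
    by (intro indep_vars_cong refl) (auto simp: fun_eq_iff vec_eq_iff grid_increments_component)
  finally have ind: "indep_vars (\<lambda>_. borel) (\<lambda>j \<omega>. grid_increments W t N \<omega> j) {..<N}" .
  have "distr M (PiM {..<N} (\<lambda>_. borel)) (\<lambda>\<omega>. \<lambda>j\<in>{..<N}. grid_increments W t N \<omega> j)
      = PiM {..<N} (\<lambda>j. distr M borel (\<lambda>\<omega>. grid_increments W t N \<omega> j))"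
    using N by (intro indep_vars_iff_distr_eq_PiM'[THEN iffD1, OF _ _ ind])
      (use ind in \<open>auto simp: indep_vars_def lessThan_empty_iff\<close>)
  also have "\<dots> = PiM {..<N} (\<lambda>_. std_gaussian_vec)"
    using distr_vector_increment[OF t] by (intro PiM_cong) auto
  also have "(\<lambda>\<omega>. \<lambda>j\<in>{..<N}. grid_increments W t N \<omega> j) = grid_increments W t N"
    by (auto simp: grid_increments_def fun_eq_iff)
  finally show ?thesis .
qed

end

section \<open>Walks and their diameters\<close>

definition seq_diam :: "(nat \<Rightarrow> 'a::metric_space) \<Rightarrow> nat \<Rightarrow> real" where
  "seq_diam f N = Max ((\<lambda>(j, k). dist (f j) (f k)) ` ({..N} \<times> {..N}))"

lemma dist_le_seq_diam: "j \<le> N \<Longrightarrow> k \<le> N \<Longrightarrow> dist (f j) (f k) \<le> seq_diam f N"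
  unfolding seq_diam_def by (rule Max_ge) auto

lemma seq_diam_le_iff: "seq_diam f N \<le> c \<longleftrightarrow> (\<forall>j\<le>N. \<forall>k\<le>N. dist (f j) (f k) \<le> c)"
  unfolding seq_diam_def by (subst Max_le_iff) auto

lemma seq_diam_nonneg [simp]: "0 \<le> seq_diam f N"
  using dist_le_seq_diam[of 0 N 0 f] by simp

lemma seq_diam_attained: obtains j k where "j \<le> N" "k \<le> N" "seq_diam f N = dist (f j) (f k)"
proof -
  have "seq_diam f N \<in> (\<lambda>(j, k). dist (f j) (f k)) ` ({..N} \<times> {..N})"
    unfolding seq_diam_def by (rule Max_in) auto
  then show ?thesis using that by auto
qed

lemma seq_diam_scale_mono:
  fixes f :: "nat \<Rightarrow> 'a::metric_space" and g :: "nat \<Rightarrow> 'b::metric_space"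
  assumes "\<And>j k. j \<le> N \<Longrightarrow> k \<le> N \<Longrightarrow> \<exists>j'\<le>N'. \<exists>k'\<le>N'. c * dist (f j) (f k) \<le> dist (g j') (g k')"
  shows "c * seq_diam f N \<le> seq_diam g N'"
proof -
  obtain j k where "j \<le> N" "k \<le> N" "seq_diam f N = dist (f j) (f k)"
    by (rule seq_diam_attained)
  moreover from assms[OF this(1,2)] obtain j' k' where "j' \<le> N'" "k' \<le> N'"
    "c * dist (f j) (f k) \<le> dist (g j') (g k')" by blast
  ultimately show ?thesis
    using dist_le_seq_diam[of j' N' k' g] by simp
qed

lemma borel_measurable_seq_diam [measurable]:
  fixes f :: "nat \<Rightarrow> 'w \<Rightarrow> 'a::{second_countable_topology, metric_space}"
  assumes "\<And>j. j \<le> N \<Longrightarrow> f j \<in> borel_measurable M"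
  shows "(\<lambda>\<omega>. seq_diam (\<lambda>j. f j \<omega>) N) \<in> borel_measurable M"
proof (rule borel_measurableI_le)
  fix c
  have "{\<omega> \<in> space M. dist (f j \<omega>) (f k \<omega>) \<le> c} \<in> sets M" if "j \<le> N" "k \<le> N" for j k
    using assms[OF that(1)] assms[OF that(2)] by simp
  then have "{\<omega> \<in> space M. \<forall>j\<in>{..N}. \<forall>k\<in>{..N}. dist (f j \<omega>) (f k \<omega>) \<le> c} \<in> sets M"
    by (intro sets.sets_Collect_finite_All) auto
  then show "{\<omega> \<in> space M. seq_diam (\<lambda>j. f j \<omega>) N \<le> c} \<in> sets M"
    by (simp only: seq_diam_le_iff Ball_def atMost_iff)
qed

definition walk :: "(nat \<Rightarrow> 'a::comm_monoid_add) \<Rightarrow> nat \<Rightarrow> 'a" where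
  "walk x j = (\<Sum>i<j. x i)"

lemma walk_simps [simp]: "walk x 0 = 0" "walk x (Suc j) = walk x j + x j"
  by (auto simp: walk_def)

lemma walk_cong: "(\<And>i. i < j \<Longrightarrow> x i = y i) \<Longrightarrow> walk x j = walk y j"
  by (simp add: walk_def)

lemma borel_measurable_walk:
  fixes \<gamma> :: "'a::{second_countable_topology, real_normed_vector} measure"
  assumes "sets \<gamma> = sets borel" "j \<le> N"
  shows "(\<lambda>x. walk x j) \<in> borel_measurable (PiM {..<N} (\<lambda>_. \<gamma>))"
proof -
  have "(\<lambda>x. x i) \<in> PiM {..<N} (\<lambda>_. \<gamma>) \<rightarrow>\<^sub>M \<gamma>" if "i < j" for i
    using that assms by (intro measurable_component_singleton) auto
  then have "(\<lambda>x. x i) \<in> borel_measurable (PiM {..<N} (\<lambda>_. \<gamma>))" if "i < j" for i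
    using that measurable_cong_sets[OF refl assms(1)] by blast
  then show ?thesis unfolding walk_def by (intro borel_measurable_sum) auto
qed

lemma walk_grid_increments:
  assumes "0 < t" "j \<le> N"
  shows "sqrt t *\<^sub>R walk (grid_increments B t N \<omega>) j = B (real j * t) \<omega> - B 0 \<omega>"
  using assms(2)
proof (induction j)
  case (Suc j)
  then show ?case using assms(1) by (simp add: grid_increments_def scaleR_add_right del: of_nat_Suc)
qed simp

lemma seq_diam_walk_grid_increments:
  assumes "0 < t"
  shows "seq_diam (\<lambda>j. B (real j * t) \<omega>) N = sqrt t * seq_diam (walk (grid_increments B t N \<omega>)) N"
proof -
  have *: "dist (B (real j * t) \<omega>) (B (real k * t) \<omega>) =
      sqrt t * dist (walk (grid_increments B t N \<omega>) j) (walk (grid_increments B t N \<omega>) k)"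
    if "j \<le> N" "k \<le> N" for j k
  proof -
    have "B (real j * t) \<omega> - B (real k * t) \<omega> =
        sqrt t *\<^sub>R (walk (grid_increments B t N \<omega>) j - walk (grid_increments B t N \<omega>) k)"
      unfolding scaleR_diff_right walk_grid_increments[OF assms that(1)]
        walk_grid_increments[OF assms that(2)] by simp
    then show ?thesis using assms by (simp only: dist_norm norm_scaleR) simp
  qed
  show ?thesis
  proof (rule antisym)
    have "seq_diam (\<lambda>j. B (real j * t) \<omega>) N \<le> c" if "c = sqrt t * seq_diam (walk (grid_increments B t N \<omega>)) N" for c
      unfolding seq_diam_le_iff that using assms by (auto simp: * intro!: dist_le_seq_diam)
    then show "seq_diam (\<lambda>j. B (real j * t) \<omega>) N \<le> sqrt t * seq_diam (walk (grid_increments B t N \<omega>)) N"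
      by simp
    show "sqrt t * seq_diam (walk (grid_increments B t N \<omega>)) N \<le> seq_diam (\<lambda>j. B (real j * t) \<omega>) N"
      using * by (intro seq_diam_scale_mono) (metis order_refl)
  qed
qed

lemma nn_integral_seq_diam_grid:
  fixes B :: "real \<Rightarrow> 'w \<Rightarrow> 'a::{second_countable_topology, real_normed_vector}"
  assumes law: "distr M (PiM {..<N} (\<lambda>_. borel)) (grid_increments B t N) = PiM {..<N} (\<lambda>_. \<gamma>)"
    and \<gamma>: "sets \<gamma> = sets borel" and t: "0 < t"
    and B: "\<And>s. 0 \<le> s \<Longrightarrow> B s \<in> borel_measurable M"
    and h [measurable]: "h \<in> borel_measurable borel"
  shows "(\<integral>\<^sup>+ \<omega>. h (seq_diam (\<lambda>j. B (real j * t) \<omega>) N) \<partial>M)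
    = (\<integral>\<^sup>+ x. h (sqrt t * seq_diam (walk x) N) \<partial>PiM {..<N} (\<lambda>_. \<gamma>))"
proof -
  have [measurable]: "grid_increments B t N \<in> M \<rightarrow>\<^sub>M PiM {..<N} (\<lambda>_. borel)"
    unfolding grid_increments_def[abs_def] using t
    by (intro measurable_restrict borel_measurable_scaleR borel_measurable_diff B) auto
  have [measurable]: "(\<lambda>x. seq_diam (walk x) N) \<in> borel_measurable (PiM {..<N} (\<lambda>_. borel :: 'a measure))"
    by (intro borel_measurable_seq_diam borel_measurable_walk) auto
  show ?thesis
    unfolding law[symmetric] seq_diam_walk_grid_increments[OF t]
    by (subst nn_integral_distr) auto
qed

section \<open>The mean squared range in dimension one\<close>

text \<open>The distance of the walk \<open>walk x\<close> below its running maximum. Applied to \<open>\<lambda>i. - x i\<close>, it is the distance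
  above the running minimum, and the two add up to the range of the walk so far. The recursion
  exhibits the pair as a Markov chain driven by the increments.\<close>
fun drawdown :: "(nat \<Rightarrow> real) \<Rightarrow> nat \<Rightarrow> real" where
  "drawdown x 0 = 0"
| "drawdown x (Suc j) = max (drawdown x j - x j) 0"

lemma drawdown_nonneg: "0 \<le> drawdown x j"
  by (cases j) auto

lemma drawdown_cong: "(\<And>i. i < j \<Longrightarrow> x i = y i) \<Longrightarrow> drawdown x j = drawdown y j"
  by (induction j) auto

lemma walk_le_drawdown: "i \<le> j \<Longrightarrow> walk x i - walk x j \<le> drawdown x j"
proof (induction j)
  case (Suc j)
  show ?case
  proof (cases "i = Suc j")
    case False
    then show ?thesis using Suc by auto
  qed auto
qed simp

lemma seq_diam_walk_le: "seq_diam (walk x) N \<le> drawdown x N + drawdown (\<lambda>i. - x i) N"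
proof -
  have "walk (\<lambda>i. - x i) j = - walk x j" for j
    by (simp add: walk_def sum_negf)
  then have "i \<le> N \<Longrightarrow> walk x N - walk x i \<le> drawdown (\<lambda>i. - x i) N" for i
    using walk_le_drawdown[of i N "\<lambda>i. - x i"] by simp
  moreover have "i \<le> N \<Longrightarrow> walk x i - walk x N \<le> drawdown x N" for i
    by (rule walk_le_drawdown)
  ultimately show ?thesis
    unfolding seq_diam_le_iff dist_real_def by (smt (verit, ccfv_threshold))
qed

text \<open>The integral of \<open>2 u / (cosh u)\<^sup>2\<close> over \<open>u \<ge> r\<close>, in closed form; its value at \<open>0\<close> is \<open>2 ln 2\<close>.\<close>
definition range_potential :: "real \<Rightarrow> real" where
  "range_potential r = 2 * (ln 2 - r * tanh r + ln (cosh r))"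

text \<open>In continuous time, the mean squared range at an independent exponential time when the current distances are \<open>X\<close>
  and \<open>Y\<close> and the current range is \<open>R = X + Y\<close>: the levels \<open>r \<le> R\<close> that have
  been passed contribute \<open>2 r\<close> each, and a level \<open>r > R\<close> contributes \<open>2 r / (cosh r)\<^sup>2\<close> times the current value
  \<open>(cosh (2 X) + cosh (2 Y)) / 2\<close> of the martingale.\<close>
definition range_gauge :: "real \<Rightarrow> real \<Rightarrow> real" where
  "range_gauge X Y = (X + Y)\<^sup>2 + (cosh (2 * X) + cosh (2 * Y)) / 2 * range_potential (X + Y)"

text \<open>Follows from \<open>2 cosh r \<ge> exp r\<close> and \<open>tanh r \<le> 1\<close>.\<close>
lemma range_potential_nonneg:
  assumes "0 \<le> r" shows "0 \<le> range_potential r"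
proof -
  have "exp r \<le> 2 * cosh r" by (simp add: cosh_field_def)
  then have "ln (exp r) \<le> ln (2 * cosh r)" by (intro ln_mono) auto
  then have "r \<le> ln 2 + ln (cosh r)" by (simp add: ln_mult)
  moreover have "r * tanh r \<le> r * 1"
    using assms by (intro mult_left_mono) (simp_all add: less_imp_le[OF tanh_real_lt_1])
  ultimately show ?thesis by (simp add: range_potential_def)
qed

lemma cosh_double_real: "cosh (2 * x) = 2 * (cosh x)\<^sup>2 - (1::real)"
  using cosh_square_eq[of x] by (simp add: cosh_double)

text \<open>What happens when the range grows from \<open>r\<close> to \<open>s\<close>: the levels \<open>u\<close> in between gain \<open>2 u\<close> and lose
  \<open>2 u * (cosh s)\<^sup>2 / (cosh u)\<^sup>2\<close>, which is more.\<close>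
lemma range_potential_tradeoff:
  assumes "0 \<le> r" "r \<le> s"
  shows "s\<^sup>2 + (cosh s)\<^sup>2 * range_potential s \<le> r\<^sup>2 + (cosh s)\<^sup>2 * range_potential r"
proof (rule DERIV_nonpos_imp_nonincreasing[OF assms(2), of "\<lambda>r. r\<^sup>2 + (cosh s)\<^sup>2 * range_potential r"])
  fix x assume x: "r \<le> x" "x \<le> s"
  have d: "((\<lambda>r. r\<^sup>2 + (cosh s)\<^sup>2 * range_potential r) has_real_derivative
      2 * x + (cosh s)\<^sup>2 * (2 * (- tanh x - x * (1 - (tanh x)\<^sup>2) + sinh x / cosh x))) (at x)"
    unfolding range_potential_def by (auto intro!: derivative_eq_intros)
  have "(cosh x)\<^sup>2 * (1 - (tanh x)\<^sup>2) = 1"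
    using hyperbolic_pythagoras[of x] cosh_real_nonzero[of x]
    by (simp add: tanh_def power_divide right_diff_distrib)
  moreover have "(cosh x)\<^sup>2 * (1 - (tanh x)\<^sup>2) \<le> (cosh s)\<^sup>2 * (1 - (tanh x)\<^sup>2)"
  proof (intro mult_right_mono power_mono)
    show "cosh x \<le> cosh s" using x assms by (subst cosh_real_nonneg_le_iff) auto
    show "0 \<le> 1 - (tanh x)\<^sup>2" using tanh_real_lt_1[of x] tanh_real_gt_neg1[of x]
      by (simp add: abs_square_le_1 abs_le_iff)
  qed simp
  ultimately have "1 \<le> (cosh s)\<^sup>2 * (1 - (tanh x)\<^sup>2)" by simp
  then have "2 * x * 1 \<le> 2 * x * ((cosh s)\<^sup>2 * (1 - (tanh x)\<^sup>2))"
    using x assms by (intro mult_left_mono) auto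
  then have "2 * x + (cosh s)\<^sup>2 * (2 * (- tanh x - x * (1 - (tanh x)\<^sup>2) + sinh x / cosh x)) \<le> 0"
    by (simp add: tanh_def algebra_simps)
  then show "\<exists>y. ((\<lambda>r. r\<^sup>2 + (cosh s)\<^sup>2 * range_potential r) has_real_derivative y) (at x) \<and> y \<le> 0"
    using d by blast
qed

lemma range_gauge_commute: "range_gauge X Y = range_gauge Y X"
  by (simp add: range_gauge_def add.commute)

text \<open>The bound for one step before averaging. If the step sets a new maximum or minimum then one of the two distances is \<open>0\<close>, the
  hyperbolic factor is \<open>(cosh R)\<^sup>2\<close> for the new range \<open>R\<close>, and \<open>range_potential_tradeoff\<close> absorbs the growth of the range;
  otherwise nothing is truncated and equality holds. On the right-hand side the potential is frozen at the
  old range, so only two hyperbolic cosines of Gaussian variables remain to be averaged.\<close>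
lemma range_gauge_step:
  assumes "0 \<le> X" "0 \<le> Y"
  shows "range_gauge (max (X - z) 0) (max (Y + z) 0)
    \<le> (X + Y)\<^sup>2 + (cosh (2 * (X - z)) + cosh (2 * (Y + z))) / 2 * range_potential (X + Y)"
proof -
  have extreme: "range_gauge 0 (Y + z)
    \<le> (X + Y)\<^sup>2 + (cosh (2 * (X - z)) + cosh (2 * (Y + z))) / 2 * range_potential (X + Y)"
    if "0 \<le> X" "0 \<le> Y" "X \<le> z" for X Y z
  proof -
    have "range_gauge 0 (Y + z) = (Y + z)\<^sup>2 + (cosh (Y + z))\<^sup>2 * range_potential (Y + z)"
      by (simp add: range_gauge_def cosh_double_real[of "Y + z", simplified])
    also have "\<dots> \<le> (X + Y)\<^sup>2 + (cosh (Y + z))\<^sup>2 * range_potential (X + Y)"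
      using that by (intro range_potential_tradeoff) auto
    also have "(cosh (Y + z))\<^sup>2 \<le> (cosh (2 * (X - z)) + cosh (2 * (Y + z))) / 2"
      using cosh_real_ge_1[of "2 * (X - z)"] unfolding cosh_double_real[of "Y + z"] by simp
    finally show ?thesis
      using range_potential_nonneg[of "X + Y"] that by (simp add: mult_right_mono)
  qed
  consider "X \<le> z" | "Y \<le> - z" | "- Y \<le> z" "z \<le> X" by linarith
  then show ?thesis
  proof cases
    case 1
    then have "max (X - z) 0 = 0" "max (Y + z) 0 = Y + z" using assms by auto
    then show ?thesis using extreme[OF assms 1] by simp
  next
    case 2
    then have "max (X - z) 0 = X - z" "max (Y + z) 0 = 0" using assms by auto
    then show ?thesis using extreme[OF assms(2,1) 2]
      by (simp add: range_gauge_commute[of _ 0] add.commute)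
  next
    case 3
    then have "max (X - z) 0 = X - z" "max (Y + z) 0 = Y + z" by auto
    then show ?thesis by (simp add: range_gauge_def)
  qed
qed

lemma borel_measurable_cosh [measurable (raw)]:
  fixes f :: "'w \<Rightarrow> real"
  assumes [measurable]: "f \<in> borel_measurable M"
  shows "(\<lambda>x. cosh (f x)) \<in> borel_measurable M"
  unfolding cosh_field_def by measurable

text \<open>Completing the square turns the exponential tilt into a shift of the normal density.\<close>
lemma nn_integral_exp_std_normal:
  assumes "0 \<le> c"
  shows "(\<integral>\<^sup>+ x. ennreal (c * exp (b * x)) \<partial>std_normal_distribution) = ennreal (c * exp (b\<^sup>2 / 2))"
proof -
  have "(\<integral>\<^sup>+ x. ennreal (c * exp (b * x)) \<partial>std_normal_distribution)
     = (\<integral>\<^sup>+ x. ennreal (std_normal_density x) * ennreal (c * exp (b * x)) \<partial>lborel)"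
    by (subst nn_integral_density) auto
  also have "\<dots> = (\<integral>\<^sup>+ x. ennreal (c * exp (b\<^sup>2 / 2)) * ennreal (normal_density b 1 x) \<partial>lborel)"
  proof (intro nn_integral_cong)
    fix x :: real
    have "- x\<^sup>2 / 2 + b * x = b\<^sup>2 / 2 + - (x - b)\<^sup>2 / 2"
      by (simp add: power2_eq_square field_simps)
    then have "exp (- x\<^sup>2 / 2) * exp (b * x) = exp (b\<^sup>2 / 2) * exp (- (x - b)\<^sup>2 / 2)"
      by (metis exp_add)
    then have "std_normal_density x * (c * exp (b * x)) = c * exp (b\<^sup>2 / 2) * normal_density b 1 x"
      unfolding normal_density_def by simp
    then show "ennreal (std_normal_density x) * ennreal (c * exp (b * x))
       = ennreal (c * exp (b\<^sup>2 / 2)) * ennreal (normal_density b 1 x)"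
      using assms by (simp add: ennreal_mult'[symmetric])
  qed
  also have "\<dots> = ennreal (c * exp (b\<^sup>2 / 2)) * (\<integral>\<^sup>+ x. ennreal (normal_density b 1 x) \<partial>lborel)"
    by (rule nn_integral_cmult) auto
  also have "(\<integral>\<^sup>+ x. ennreal (normal_density b 1 x) \<partial>lborel) = 1"
    using prob_space.emeasure_space_1[OF prob_space_normal_density[of 1 b]]
    by (simp add: emeasure_density)
  finally show ?thesis by simp
qed

lemma nn_integral_cosh_std_normal:
  assumes "0 \<le> c"
  shows "(\<integral>\<^sup>+ x. ennreal (c * cosh (a + b * x)) \<partial>std_normal_distribution)
    = ennreal (c * (exp (b\<^sup>2 / 2) * cosh a))"
proof -
  let ?c = "c * exp a / 2" and ?d = "c * exp (- a) / 2"
  have "(\<integral>\<^sup>+ x. ennreal (c * cosh (a + b * x)) \<partial>std_normal_distribution)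
    = (\<integral>\<^sup>+ x. ennreal (?c * exp (b * x)) + ennreal (?d * exp ((- b) * x)) \<partial>std_normal_distribution)"
  proof (intro nn_integral_cong)
    fix x
    have "c * cosh (a + b * x) = ?c * exp (b * x) + ?d * exp ((- b) * x)"
      by (simp add: cosh_field_def exp_add exp_diff exp_minus field_simps)
    then show "ennreal (c * cosh (a + b * x)) = ennreal (?c * exp (b * x)) + ennreal (?d * exp ((- b) * x))"
      using assms by (simp only:) (subst ennreal_plus, auto)
  qed
  also have "\<dots> = (\<integral>\<^sup>+ x. ennreal (?c * exp (b * x)) \<partial>std_normal_distribution)
      + (\<integral>\<^sup>+ x. ennreal (?d * exp ((- b) * x)) \<partial>std_normal_distribution)"
    by (rule nn_integral_add) auto
  also have "\<dots> = ennreal (?c * exp (b\<^sup>2 / 2)) + ennreal (?d * exp ((- b)\<^sup>2 / 2))"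
    using assms by (subst (1 2) nn_integral_exp_std_normal) auto
  also have "\<dots> = ennreal (?c * exp (b\<^sup>2 / 2) + ?d * exp ((- b)\<^sup>2 / 2))"
    using assms by (subst ennreal_plus) auto
  also have "?c * exp (b\<^sup>2 / 2) + ?d * exp ((- b)\<^sup>2 / 2) = c * (exp (b\<^sup>2 / 2) * cosh a)"
    by (simp add: cosh_field_def field_simps)
  finally show ?thesis .
qed

text \<open>The discount \<open>q\<close> is exactly what compensates the growth factor \<open>exp ((2 \<sigma>)\<^sup>2 / 2)\<close> of both hyperbolic cosines.\<close>
lemma range_gauge_mean_step:
  assumes "0 \<le> X" "0 \<le> Y" and q: "q = exp (- (2 * \<sigma>\<^sup>2))"
  shows "ennreal q * (\<integral>\<^sup>+ z. ennreal (range_gauge (max (X - \<sigma> * z) 0) (max (Y + \<sigma> * z) 0)) \<partial>std_normal_distribution)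
      + ennreal ((1 - q) * (X + Y)\<^sup>2) \<le> ennreal (range_gauge X Y)"
proof -
  let ?H = "range_potential (X + Y)"
  have H: "0 \<le> ?H" using assms by (intro range_potential_nonneg) auto
  have q1: "0 \<le> q" "q \<le> 1" by (auto simp: q)
  let ?C = "\<lambda>a b z. ennreal (?H / 2 * cosh (a + b * z))"
  have "(\<integral>\<^sup>+ z. ennreal (range_gauge (max (X - \<sigma> * z) 0) (max (Y + \<sigma> * z) 0)) \<partial>std_normal_distribution)
    \<le> (\<integral>\<^sup>+ z. ennreal ((X + Y)\<^sup>2) + (?C (2 * X) (- 2 * \<sigma>) z + ?C (2 * Y) (2 * \<sigma>) z) \<partial>std_normal_distribution)"
  proof (intro nn_integral_mono)
    fix z
    have "range_gauge (max (X - \<sigma> * z) 0) (max (Y + \<sigma> * z) 0)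
      \<le> (X + Y)\<^sup>2 + (?H / 2 * cosh (2 * X + (- 2 * \<sigma>) * z) + ?H / 2 * cosh (2 * Y + (2 * \<sigma>) * z))"
      using range_gauge_step[OF assms(1,2), of "\<sigma> * z"] by (simp add: algebra_simps add_divide_distrib)
    then have "ennreal (range_gauge (max (X - \<sigma> * z) 0) (max (Y + \<sigma> * z) 0))
      \<le> ennreal ((X + Y)\<^sup>2 + (?H / 2 * cosh (2 * X + (- 2 * \<sigma>) * z) + ?H / 2 * cosh (2 * Y + (2 * \<sigma>) * z)))"
      by (rule ennreal_leI)
    also have "\<dots> = ennreal ((X + Y)\<^sup>2) + (?C (2 * X) (- 2 * \<sigma>) z + ?C (2 * Y) (2 * \<sigma>) z)"
      using H by (subst ennreal_plus; (subst ennreal_plus)?) auto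
    finally show "ennreal (range_gauge (max (X - \<sigma> * z) 0) (max (Y + \<sigma> * z) 0))
      \<le> ennreal ((X + Y)\<^sup>2) + (?C (2 * X) (- 2 * \<sigma>) z + ?C (2 * Y) (2 * \<sigma>) z)" .
  qed
  also have "\<dots> = (\<integral>\<^sup>+ z. ennreal ((X + Y)\<^sup>2) \<partial>std_normal_distribution) +
      ((\<integral>\<^sup>+ z. ?C (2 * X) (- 2 * \<sigma>) z \<partial>std_normal_distribution)
        + (\<integral>\<^sup>+ z. ?C (2 * Y) (2 * \<sigma>) z \<partial>std_normal_distribution))"
    by (subst nn_integral_add; (subst nn_integral_add)?) auto
  also have "\<dots> = ennreal ((X + Y)\<^sup>2) + (ennreal (?H / 2 * (exp ((- 2 * \<sigma>)\<^sup>2 / 2) * cosh (2 * X)))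
      + ennreal (?H / 2 * (exp ((2 * \<sigma>)\<^sup>2 / 2) * cosh (2 * Y))))"
  proof -
    have "(\<integral>\<^sup>+ z. ennreal ((X + Y)\<^sup>2) \<partial>std_normal_distribution) = ennreal ((X + Y)\<^sup>2)"
      using prob_space.emeasure_space_1[OF prob_space_std_normal] by simp
    then show ?thesis
      using H by (subst (1 2) nn_integral_cosh_std_normal) auto
  qed
  also have "\<dots> = ennreal ((X + Y)\<^sup>2 + (?H / 2 * (exp ((- 2 * \<sigma>)\<^sup>2 / 2) * cosh (2 * X))
      + ?H / 2 * (exp ((2 * \<sigma>)\<^sup>2 / 2) * cosh (2 * Y))))"
    using H by (subst ennreal_plus; (subst ennreal_plus)?) auto
  also have "(X + Y)\<^sup>2 + (?H / 2 * (exp ((- 2 * \<sigma>)\<^sup>2 / 2) * cosh (2 * X))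
      + ?H / 2 * (exp ((2 * \<sigma>)\<^sup>2 / 2) * cosh (2 * Y)))
      = (X + Y)\<^sup>2 + exp (2 * \<sigma>\<^sup>2) * ((cosh (2 * X) + cosh (2 * Y)) / 2 * ?H)"
    by (simp add: power_mult_distrib algebra_simps add_divide_distrib)
  finally have "ennreal q * (\<integral>\<^sup>+ z. ennreal (range_gauge (max (X - \<sigma> * z) 0) (max (Y + \<sigma> * z) 0)) \<partial>std_normal_distribution)
      + ennreal ((1 - q) * (X + Y)\<^sup>2)
    \<le> ennreal q * ennreal ((X + Y)\<^sup>2 + exp (2 * \<sigma>\<^sup>2) * ((cosh (2 * X) + cosh (2 * Y)) / 2 * ?H)) + ennreal ((1 - q) * (X + Y)\<^sup>2)"
    by (intro add_right_mono mult_left_mono) auto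
  also have "\<dots> = ennreal (q * ((X + Y)\<^sup>2 + exp (2 * \<sigma>\<^sup>2) * ((cosh (2 * X) + cosh (2 * Y)) / 2 * ?H)) + (1 - q) * (X + Y)\<^sup>2)"
    using H q1 by (subst ennreal_plus) (auto simp: ennreal_mult)
  also have "q * ((X + Y)\<^sup>2 + exp (2 * \<sigma>\<^sup>2) * ((cosh (2 * X) + cosh (2 * Y)) / 2 * ?H)) + (1 - q) * (X + Y)\<^sup>2
     = range_gauge X Y"
  proof -
    have "q * exp (2 * \<sigma>\<^sup>2) = 1" by (simp add: q exp_minus field_simps)
    moreover have "q * (a + e * b) + (1 - q) * a = a + (q * e) * b" for a b e
      by (simp add: algebra_simps)
    ultimately show ?thesis by (simp only: range_gauge_def mult_1)
  qed
  finally show ?thesis .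
qed

lemma borel_measurable_drawdown:
  assumes "j \<le> N"
  shows "(\<lambda>x. drawdown x j) \<in> borel_measurable (PiM {..<N} (\<lambda>_. std_normal_distribution))"
    and "(\<lambda>x. drawdown (\<lambda>i. - x i) j) \<in> borel_measurable (PiM {..<N} (\<lambda>_. std_normal_distribution))"
proof -
  have m: "(\<lambda>x. x i) \<in> borel_measurable (PiM {..<N} (\<lambda>_. std_normal_distribution))" if "i < N" for i
    using that measurable_component_singleton[of i "{..<N}" "\<lambda>_. std_normal_distribution"] by simp
  show "(\<lambda>x. drawdown x j) \<in> borel_measurable (PiM {..<N} (\<lambda>_. std_normal_distribution))"
    using assms by (induction j) (auto intro!: borel_measurable_max borel_measurable_diff m)
  show "(\<lambda>x. drawdown (\<lambda>i. - x i) j) \<in> borel_measurable (PiM {..<N} (\<lambda>_. std_normal_distribution))"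
    using assms by (induction j) (auto intro!: borel_measurable_max borel_measurable_add m)
qed

lemma borel_measurable_range_potential [measurable]: "range_potential \<in> borel_measurable borel"
proof -
  have "continuous_on UNIV range_potential"
    unfolding range_potential_def by (intro continuous_intros) auto
  then show ?thesis by (rule borel_measurable_continuous_onI)
qed

lemma borel_measurable_range_gauge [measurable (raw)]:
  assumes [measurable]: "f \<in> borel_measurable M" "g \<in> borel_measurable M"
  shows "(\<lambda>x. range_gauge (f x) (g x)) \<in> borel_measurable M"
  unfolding range_gauge_def by measurable

text \<open>The terms \<open>(1 - q) * q ^ j\<close> are the weights of a geometric time, the discrete counterpart of the exponential time. The second
  summand keeps the induction going; it is nonnegative.\<close>
lemma discounted_range_sum_le:
  assumes \<sigma>: "0 \<le> \<sigma>" and q: "q = exp (- (2 * \<sigma>\<^sup>2))"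
  defines "P \<equiv> \<lambda>n. PiM {..<n} (\<lambda>_::nat. std_normal_distribution)"
  defines "X \<equiv> \<lambda>n x. \<sigma> * drawdown x n" and "Y \<equiv> \<lambda>n x. \<sigma> * drawdown (\<lambda>i. - x i) n"
  shows "(\<Sum>j<n. ennreal ((1 - q) * q ^ j) * (\<integral>\<^sup>+ x. ennreal ((X j x + Y j x)\<^sup>2) \<partial>P j))
    + ennreal (q ^ n) * (\<integral>\<^sup>+ x. ennreal (range_gauge (X n x) (Y n x)) \<partial>P n) \<le> ennreal (2 * ln 2)"
proof (induction n)
  case 0
  have "prob_space (P 0)" unfolding P_def by (intro prob_space_PiM) auto
  then show ?case
    by (simp add: X_def Y_def range_gauge_def range_potential_def prob_space.emeasure_space_1)
next
  case (Suc n)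
  interpret product_sigma_finite "\<lambda>_::nat. std_normal_distribution"
    by (intro product_sigma_finite.intro prob_space_imp_sigma_finite) auto
  have q0: "0 \<le> q" "q \<le> 1" by (auto simp: q)
  have [measurable]: "X n \<in> borel_measurable (P n)" "Y n \<in> borel_measurable (P n)"
    unfolding X_def Y_def P_def by (intro borel_measurable_times borel_measurable_drawdown; simp)+
  have [measurable]: "X (Suc n) \<in> borel_measurable (P (Suc n))" "Y (Suc n) \<in> borel_measurable (P (Suc n))"
    unfolding X_def Y_def P_def by (intro borel_measurable_times borel_measurable_drawdown; simp)+
  have upd: "X (Suc n) (x(n := z)) = max (X n x - \<sigma> * z) 0" "Y (Suc n) (x(n := z)) = max (Y n x + \<sigma> * z) 0" for x z
  proof -
    have "drawdown (x(n := z)) n = drawdown x n" "drawdown (\<lambda>i. - (x(n := z)) i) n = drawdown (\<lambda>i. - x i) n"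
      by (rule drawdown_cong; simp)+
    then show "X (Suc n) (x(n := z)) = max (X n x - \<sigma> * z) 0" "Y (Suc n) (x(n := z)) = max (Y n x + \<sigma> * z) 0"
      using \<sigma> by (simp_all add: X_def Y_def max_mult_distrib_left right_diff_distrib distrib_left)
  qed
  have meas: "(\<lambda>x. \<integral>\<^sup>+ z. ennreal (range_gauge (max (X n x - \<sigma> * z) 0) (max (Y n x + \<sigma> * z) 0)) \<partial>std_normal_distribution)
     \<in> borel_measurable (P n)"
    by (intro sigma_finite_measure.borel_measurable_nn_integral prob_space_imp_sigma_finite) measurable
  have "(\<integral>\<^sup>+ x. ennreal (range_gauge (X (Suc n) x) (Y (Suc n) x)) \<partial>P (Suc n))
     = (\<integral>\<^sup>+ x. \<integral>\<^sup>+ z. ennreal (range_gauge (max (X n x - \<sigma> * z) 0) (max (Y n x + \<sigma> * z) 0)) \<partial>std_normal_distribution \<partial>P n)"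
  proof -
    have "(\<lambda>x. ennreal (range_gauge (X (Suc n) x) (Y (Suc n) x))) \<in> borel_measurable (P (Suc n))"
      by measurable
    then show ?thesis
      unfolding P_def lessThan_Suc by (subst product_nn_integral_insert) (simp_all add: upd)
  qed
  then have "ennreal q * (\<integral>\<^sup>+ x. ennreal (range_gauge (X (Suc n) x) (Y (Suc n) x)) \<partial>P (Suc n))
      + ennreal (1 - q) * (\<integral>\<^sup>+ x. ennreal ((X n x + Y n x)\<^sup>2) \<partial>P n)
    = (\<integral>\<^sup>+ x. ennreal q * (\<integral>\<^sup>+ z. ennreal (range_gauge (max (X n x - \<sigma> * z) 0) (max (Y n x + \<sigma> * z) 0)) \<partial>std_normal_distribution)
        + ennreal (1 - q) * ennreal ((X n x + Y n x)\<^sup>2) \<partial>P n)"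
    by (subst nn_integral_add, use meas in measurable, subst (1 2) nn_integral_cmult, use meas in measurable)
  also have "\<dots> \<le> (\<integral>\<^sup>+ x. ennreal (range_gauge (X n x) (Y n x)) \<partial>P n)"
  proof (intro nn_integral_mono)
    fix x
    have "0 \<le> X n x" "0 \<le> Y n x" using \<sigma> by (auto simp: X_def Y_def drawdown_nonneg)
    from range_gauge_mean_step[OF this q] q0
    show "ennreal q * (\<integral>\<^sup>+ z. ennreal (range_gauge (max (X n x - \<sigma> * z) 0) (max (Y n x + \<sigma> * z) 0)) \<partial>std_normal_distribution)
        + ennreal (1 - q) * ennreal ((X n x + Y n x)\<^sup>2) \<le> ennreal (range_gauge (X n x) (Y n x))"
      by (simp add: ennreal_mult'[symmetric] ennreal_mult[symmetric])
  qed
  finally have step: "ennreal (q ^ n) * (ennreal q * (\<integral>\<^sup>+ x. ennreal (range_gauge (X (Suc n) x) (Y (Suc n) x)) \<partial>P (Suc n))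
      + ennreal (1 - q) * (\<integral>\<^sup>+ x. ennreal ((X n x + Y n x)\<^sup>2) \<partial>P n))
    \<le> ennreal (q ^ n) * (\<integral>\<^sup>+ x. ennreal (range_gauge (X n x) (Y n x)) \<partial>P n)"
    by (rule mult_left_mono) simp
  have distr: "ennreal (q ^ n) * (ennreal q * u + ennreal (1 - q) * v) =
      ennreal ((1 - q) * q ^ n) * v + ennreal (q ^ Suc n) * u" for u v
  proof -
    have "ennreal (q ^ Suc n) = ennreal (q ^ n) * ennreal q" "ennreal ((1 - q) * q ^ n) = ennreal (q ^ n) * ennreal (1 - q)"
      using q0 by (simp_all add: ennreal_mult[symmetric] mult.commute)
    then show ?thesis by (simp only: distrib_left mult.assoc add.commute)
  qed
  have "ennreal ((1 - q) * q ^ n) * (\<integral>\<^sup>+ x. ennreal ((X n x + Y n x)\<^sup>2) \<partial>P n)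
     + ennreal (q ^ Suc n) * (\<integral>\<^sup>+ x. ennreal (range_gauge (X (Suc n) x) (Y (Suc n) x)) \<partial>P (Suc n))
    \<le> ennreal (q ^ n) * (\<integral>\<^sup>+ x. ennreal (range_gauge (X n x) (Y n x)) \<partial>P n)"
    using step unfolding distr .
  then show ?case
    using Suc.IH unfolding sum.lessThan_Suc add.assoc by (rule order_trans[OF add_left_mono])
qed

definition mean_sq_range :: "nat \<Rightarrow> ennreal" where
  "mean_sq_range N = (\<integral>\<^sup>+ x. ennreal ((seq_diam (walk x) N)\<^sup>2) \<partial>PiM {..<N} (\<lambda>_. std_normal_distribution))"

lemma discounted_mean_sq_range_le:
  assumes s: "0 \<le> s" and q: "q = exp (- (2 * s))"
  shows "(\<Sum>j<n. ennreal ((1 - q) * q ^ j * s) * mean_sq_range j) \<le> ennreal (2 * ln 2)"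
proof -
  let ?P = "\<lambda>n. PiM {..<n} (\<lambda>_::nat. std_normal_distribution)"
  have q': "q = exp (- (2 * (sqrt s)\<^sup>2))" and q0: "0 \<le> q" "q \<le> 1" using s q by auto
  have "ennreal ((1 - q) * q ^ j * s) * mean_sq_range j
    \<le> ennreal ((1 - q) * q ^ j) * (\<integral>\<^sup>+ x. ennreal ((sqrt s * drawdown x j + sqrt s * drawdown (\<lambda>i. - x i) j)\<^sup>2) \<partial>?P j)" for j
  proof -
    have m: "(\<lambda>x. ennreal ((seq_diam (walk x) j)\<^sup>2)) \<in> borel_measurable (?P j)"
      by (intro measurable_compose[OF _ measurable_ennreal] borel_measurable_power
          borel_measurable_seq_diam borel_measurable_walk) auto
    have "ennreal s * mean_sq_range j = (\<integral>\<^sup>+ x. ennreal s * ennreal ((seq_diam (walk x) j)\<^sup>2) \<partial>?P j)"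
      unfolding mean_sq_range_def by (rule nn_integral_cmult[OF m, symmetric])
    also have "\<dots> \<le> (\<integral>\<^sup>+ x. ennreal ((sqrt s * drawdown x j + sqrt s * drawdown (\<lambda>i. - x i) j)\<^sup>2) \<partial>?P j)"
    proof (intro nn_integral_mono)
      fix x :: "nat \<Rightarrow> real"
      have "s * (seq_diam (walk x) j)\<^sup>2 \<le> s * (drawdown x j + drawdown (\<lambda>i. - x i) j)\<^sup>2"
        using s by (intro mult_left_mono power_mono seq_diam_walk_le) auto
      also have "\<dots> = (sqrt s * drawdown x j + sqrt s * drawdown (\<lambda>i. - x i) j)\<^sup>2"
        using s by (simp add: distrib_left[symmetric] power_mult_distrib)
      finally show "ennreal s * ennreal ((seq_diam (walk x) j)\<^sup>2)
          \<le> ennreal ((sqrt s * drawdown x j + sqrt s * drawdown (\<lambda>i. - x i) j)\<^sup>2)"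
        using s by (simp add: ennreal_mult'[symmetric] ennreal_leI)
    qed
    finally have "ennreal ((1 - q) * q ^ j) * (ennreal s * mean_sq_range j) \<le>
        ennreal ((1 - q) * q ^ j) * (\<integral>\<^sup>+ x. ennreal ((sqrt s * drawdown x j + sqrt s * drawdown (\<lambda>i. - x i) j)\<^sup>2) \<partial>?P j)"
      by (rule mult_left_mono) simp
    then show ?thesis
      using s q0 by (simp add: ennreal_mult mult.assoc)
  qed
  then have "(\<Sum>j<n. ennreal ((1 - q) * q ^ j * s) * mean_sq_range j)
    \<le> (\<Sum>j<n. ennreal ((1 - q) * q ^ j) * (\<integral>\<^sup>+ x. ennreal ((sqrt s * drawdown x j + sqrt s * drawdown (\<lambda>i. - x i) j)\<^sup>2) \<partial>?P j))"
    by (intro sum_mono)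
  also have "\<dots> \<le> ennreal (2 * ln 2)"
    using discounted_range_sum_le[of "sqrt s" q n, OF _ q'] s
    by (meson add_increasing2 order_trans zero_le le_iff_add real_sqrt_ge_zero)
  finally show ?thesis .
qed

context
  fixes M :: "'w measure" and B :: "real \<Rightarrow> 'w \<Rightarrow> real"
  assumes BM: "std_brownian_motion_1d M B"
begin

lemma nn_integral_sq_range_grid:
  assumes t: "0 < t" and N: "0 < N"
  shows "(\<integral>\<^sup>+ \<omega>. ennreal ((seq_diam (\<lambda>j. B (real j * t) \<omega>) N)\<^sup>2) \<partial>M) = ennreal t * mean_sq_range N"
proof -
  have "(\<integral>\<^sup>+ \<omega>. ennreal ((seq_diam (\<lambda>j. B (real j * t) \<omega>) N)\<^sup>2) \<partial>M)
    = (\<integral>\<^sup>+ x. ennreal ((sqrt t * seq_diam (walk x) N)\<^sup>2) \<partial>PiM {..<N} (\<lambda>_. std_normal_distribution))"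
    by (rule nn_integral_seq_diam_grid[OF distr_grid_increments[OF BM t N] _ t std_brownian_motion_1d_measurable[OF BM]])
      auto
  also have "\<dots> = (\<integral>\<^sup>+ x. ennreal t * ennreal ((seq_diam (walk x) N)\<^sup>2) \<partial>PiM {..<N} (\<lambda>_. std_normal_distribution))"
    using t by (simp add: power_mult_distrib ennreal_mult')
  also have "\<dots> = ennreal t * mean_sq_range N"
    unfolding mean_sq_range_def
    by (intro nn_integral_cmult measurable_compose[OF _ measurable_ennreal] borel_measurable_power
          borel_measurable_seq_diam borel_measurable_walk) auto
  finally show ?thesis .
qed

text \<open>Observed only at multiples of \<open>m = j div N\<close>, the walk of \<open>j\<close> steps contains a walk of \<open>N\<close> steps of
  variance \<open>m\<close>. Brownian motion supplies both walks on one probability space.\<close>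
lemma mean_sq_range_superlinear:
  assumes N: "0 < N"
  shows "ennreal (real (j div N)) * mean_sq_range N \<le> mean_sq_range j"
proof (cases "j div N = 0")
  case False
  define m where "m = j div N"
  then have m: "0 < m" and mj: "m * N \<le> j" using False by (auto simp: div_times_less_eq_dividend)
  then have j: "0 < j" using N by (metis mult_is_0 not_gr_zero le_zero_eq less_numeral_extra(3))
  have "ennreal (real m) * mean_sq_range N = (\<integral>\<^sup>+ \<omega>. ennreal ((seq_diam (\<lambda>k. B (real k * real m) \<omega>) N)\<^sup>2) \<partial>M)"
    using m N by (intro nn_integral_sq_range_grid[symmetric]) auto
  also have "\<dots> \<le> (\<integral>\<^sup>+ \<omega>. ennreal ((seq_diam (\<lambda>k. B (real k * 1) \<omega>) j)\<^sup>2) \<partial>M)"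
  proof (intro nn_integral_mono ennreal_leI power_mono seq_diam_nonneg)
    fix \<omega>
    have le: "k * m \<le> j" if "k \<le> N" for k
    proof -
      have "k * m \<le> N * m" using that by (rule mult_le_mono1)
      also have "\<dots> = m * N" by (rule mult.commute)
      finally show ?thesis using mj by linarith
    qed
    show "seq_diam (\<lambda>k. B (real k * real m) \<omega>) N \<le> seq_diam (\<lambda>k. B (real k * 1) \<omega>) j"
      unfolding seq_diam_le_iff
    proof (intro allI impI)
      fix k l assume "k \<le> N" "l \<le> N"
      from dist_le_seq_diam[OF le[OF this(1)] le[OF this(2)], of "\<lambda>k. B (real k * 1) \<omega>"]
      show "dist (B (real k * real m) \<omega>) (B (real l * real m) \<omega>) \<le> seq_diam (\<lambda>k. B (real k * 1) \<omega>) j"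
        by simp
    qed
  qed
  also have "\<dots> = mean_sq_range j"
    using j by (subst nn_integral_sq_range_grid) auto
  finally show ?thesis by (simp add: m_def)
qed simp

text \<open>An Abelian argument: by superlinearity the mean squared range grows at least like \<open>(j - N) / N\<close> times its value at \<open>N\<close>, so the
  discounted sums bound \<open>s * (1 / (1 - exp (- 2 s)) - (N + 1)) * mean_sq_range N / N\<close> by \<open>2 ln 2\<close>. The limit \<open>s \<rightarrow> 0\<close> gives
  half of \<open>mean_sq_range N / N\<close>.\<close>
lemma mean_sq_range_le:
  assumes N: "0 < N"
  shows "mean_sq_range N \<le> ennreal (4 * ln 2 * real N)"
proof -
  define q where "q s = exp (- (2 * s))" for s :: real
  have q: "0 < q s" "q s < 1" if "0 < s" for s using that by (auto simp: q_def)
  \<comment> \<open>A single term of the discounted sum has a positive weight, so finiteness comes with the bound.\<close>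
  have fin: "mean_sq_range N < \<top>"
  proof -
    let ?c = "(1 - q 1) * q 1 ^ N * 1"
    have "ennreal ?c * mean_sq_range N \<le> (\<Sum>j<Suc N. ennreal ((1 - q 1) * q 1 ^ j * 1) * mean_sq_range j)"
      by simp
    also have "\<dots> \<le> ennreal (2 * ln 2)"
      by (rule discounted_mean_sq_range_le) (auto simp: q_def)
    finally have "ennreal ?c * mean_sq_range N < \<top>"
      using ennreal_less_top le_less_trans by blast
    moreover have "ennreal ?c \<noteq> 0" using q[of 1] by simp
    ultimately show ?thesis by (auto simp: ennreal_mult_less_top)
  qed
  define r where "r = enn2real (mean_sq_range N)"
  have r: "mean_sq_range N = ennreal r" "0 \<le> r" using fin by (auto simp: r_def)
  have bound: "s * (1 / (1 - q s) - real (N + 1)) * (r / real N) \<le> 2 * ln 2" if s: "0 < s" for s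
  proof -
    note qs = q[OF s]
    have "(\<Sum>j<n. (real (Suc j) * q s ^ j - real (N + 1) * q s ^ j)) * ((1 - q s) * s * (r / real N)) \<le> 2 * ln 2" for n
    proof -
      have "(\<Sum>j<n. (1 - q s) * q s ^ j * s * (real (j div N) * r)) \<le> 2 * ln 2"
      proof -
        have "ennreal (\<Sum>j<n. (1 - q s) * q s ^ j * s * (real (j div N) * r))
           = (\<Sum>j<n. ennreal ((1 - q s) * q s ^ j * s) * (ennreal (real (j div N)) * mean_sq_range N))"
          using qs s r by (subst sum_ennreal[symmetric]) (auto simp: ennreal_mult)
        also have "\<dots> \<le> (\<Sum>j<n. ennreal ((1 - q s) * q s ^ j * s) * mean_sq_range j)"
          by (intro sum_mono mult_left_mono mean_sq_range_superlinear N) auto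
        also have "\<dots> \<le> ennreal (2 * ln 2)"
          using s by (intro discounted_mean_sq_range_le) (auto simp: q_def)
        finally show ?thesis by (subst (asm) ennreal_le_iff) auto
      qed
      moreover have "(\<Sum>j<n. (real (Suc j) * q s ^ j - real (N + 1) * q s ^ j)) * ((1 - q s) * s * (r / real N))
        \<le> (\<Sum>j<n. (1 - q s) * q s ^ j * s * (real (j div N) * r))"
        unfolding sum_distrib_right
      proof (intro sum_mono)
        fix j
        have "real j - real N \<le> real (j div N) * real N"
        proof -
          have "j < (j div N) * N + N" using N by (metis add.commute dividend_less_div_times mult.commute)
          then have "real j < real ((j div N) * N + N)" by linarith
          then show ?thesis by simp
        qed
        then have "(real j - real N) / real N \<le> real (j div N)" using N by (simp add: field_simps)
        then have "((1 - q s) * q s ^ j * s * r) * ((real j - real N) / real N) \<le> ((1 - q s) * q s ^ j * s * r) * real (j div N)"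
          using qs s r by (intro mult_left_mono) auto
        moreover have "((J + 1) * p - (n + 1) * p) * (d * s * (r * i)) = (d * p * s * r) * ((J - n) * i)"
          for J p n d i :: real
          by (simp add: algebra_simps)
        from this[of "real j" "q s ^ j" "real N" "1 - q s" "inverse (real N)"]
        have "(real (Suc j) * q s ^ j - real (N + 1) * q s ^ j) * ((1 - q s) * s * (r / real N))
           = ((1 - q s) * q s ^ j * s * r) * ((real j - real N) / real N)"
          by (simp only: divide_inverse of_nat_Suc of_nat_add of_nat_1 add.commute)
        ultimately show "(real (Suc j) * q s ^ j - real (N + 1) * q s ^ j) * ((1 - q s) * s * (r / real N))
           \<le> (1 - q s) * q s ^ j * s * (real (j div N) * r)"
          by (simp only: mult.assoc mult.commute[of r])
      qed
      ultimately show ?thesis by simp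
    qed
    moreover have "(\<lambda>j. real (Suc j) * q s ^ j - real (N + 1) * q s ^ j) sums (1 / (1 - q s)\<^sup>2 - real (N + 1) * (1 / (1 - q s)))"
      using qs by (intro sums_diff sums_mult geometric_deriv_sums geometric_sums) auto
    then have "(\<lambda>n. (\<Sum>j<n. (real (Suc j) * q s ^ j - real (N + 1) * q s ^ j)) * ((1 - q s) * s * (r / real N))) \<longlonglongrightarrow>
       (1 / (1 - q s)\<^sup>2 - real (N + 1) * (1 / (1 - q s))) * ((1 - q s) * s * (r / real N))"
      unfolding sums_def by (intro tendsto_mult_right)
    ultimately have "(1 / (1 - q s)\<^sup>2 - real (N + 1) * (1 / (1 - q s))) * ((1 - q s) * s * (r / real N)) \<le> 2 * ln 2"
      by (intro LIMSEQ_le_const2) auto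
    also have "(1 / (1 - q s)\<^sup>2 - real (N + 1) * (1 / (1 - q s))) * ((1 - q s) * s * (r / real N))
       = s * (1 / (1 - q s) - real (N + 1)) * (r / real N)"
    proof -
      have "(1 / d\<^sup>2 - m * (1 / d)) * (d * s * p) = s * (1 / d - m) * p" if "d \<noteq> 0" for d m p :: real
        using that by (simp add: field_simps power2_eq_square)
      then show ?thesis using qs by simp
    qed
    finally show ?thesis .
  qed
  have "((\<lambda>s::real. s * (1 / (1 - exp (- (2 * s))) - c)) \<longlongrightarrow> 1 / 2) (at_right 0)" for c
    by real_asymp
  then have "((\<lambda>s. s * (1 / (1 - q s) - real (N + 1)) * (r / real N)) \<longlongrightarrow> 1 / 2 * (r / real N)) (at_right 0)"
    unfolding q_def by (intro tendsto_mult_right)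
  moreover have "\<forall>\<^sub>F s in at_right 0. s * (1 / (1 - q s) - real (N + 1)) * (r / real N) \<le> 2 * ln 2"
    using eventually_at_right_less by (rule eventually_mono) (rule bound)
  ultimately have "1 / 2 * (r / real N) \<le> 2 * ln 2"
    by (rule tendsto_upperbound) simp
  then have "r \<le> 4 * ln 2 * real N" using N by (simp add: field_simps)
  then show ?thesis unfolding r by (rule ennreal_leI)
qed

end

section \<open>The exit of a Gaussian walk from the unit ball\<close>

lemma distr_std_gaussian_vec_component:
  "distr std_gaussian_vec borel (\<lambda>x. x $ i) = std_normal_distribution"
proof -
  have "distr std_gaussian_vec borel (\<lambda>x. x $ i)
    = distr (PiM UNIV (\<lambda>_. std_normal_distribution)) std_normal_distribution (\<lambda>x. x i)"
    unfolding std_gaussian_vec_def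
    by (subst distr_distr) (auto simp: comp_def intro!: distr_cong borel_measurable_nth)
  also have "\<dots> = std_normal_distribution"
    by (rule distr_PiM_component) auto
  finally show ?thesis .
qed

lemma std_gaussian_vec_moments:
  fixes i :: "'n::finite"
  shows "integrable std_gaussian_vec (\<lambda>x. (x $ i) ^ k)"
    and "(LINT x|std_gaussian_vec. x $ i) = 0"
    and "(LINT x|std_gaussian_vec. (x $ i)\<^sup>2) = 1"
    and "(LINT x|std_gaussian_vec. (x $ i) ^ 4) = 3"
proof -
  have m: "(\<lambda>x::real^'n. x $ i) \<in> borel_measurable std_gaussian_vec"
    by (simp add: borel_measurable_nth measurable_cong_sets[OF sets_std_gaussian_vec refl])
  have tr: "(LINT x|std_gaussian_vec. (x $ i) ^ k) = (LINT z|std_normal_distribution. z ^ k)" for k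
    unfolding distr_std_gaussian_vec_component[of i, symmetric]
    by (subst integral_distr) (auto simp: m)
  show "integrable std_gaussian_vec (\<lambda>x. (x $ i) ^ k)"
    using integrable_std_normal_distribution_moment[of k]
    unfolding distr_std_gaussian_vec_component[of i, symmetric]
    by (subst (asm) integrable_distr_eq) (auto simp: m)
  show "(LINT x|std_gaussian_vec. x $ i) = 0"
    using tr[of 1] integral_std_normal_distribution_moment_odd[of 1] by simp
  show "(LINT x|std_gaussian_vec. (x $ i)\<^sup>2) = 1"
    using tr[of 2] std_normal_distribution_even_moments(1)[of 1] by (simp add: fact_numeral)
  show "(LINT x|std_gaussian_vec. (x $ i) ^ 4) = 3"
    using tr[of 4] std_normal_distribution_even_moments(1)[of 2] by (simp add: fact_numeral)
qed

lemma norm_power4_le_sum: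
  fixes y :: "real ^ 'n"
  shows "norm y ^ 4 \<le> real CARD('n) * (\<Sum>i\<in>UNIV. (y $ i) ^ 4)"
proof -
  have "norm y ^ 4 = ((norm y)\<^sup>2)\<^sup>2" by (simp add: power2_eq_square power4_eq_xxxx)
  also have "(norm y)\<^sup>2 = (\<Sum>i\<in>UNIV. (y $ i)\<^sup>2 * 1)"
    by (simp add: norm_vec_def L2_set_def sum_nonneg)
  also have "(\<Sum>i\<in>UNIV. (y $ i)\<^sup>2 * 1)\<^sup>2 \<le> (\<Sum>i\<in>UNIV. ((y $ i)\<^sup>2)\<^sup>2) * (\<Sum>i\<in>(UNIV::'n set). 1\<^sup>2)"
    by (rule Cauchy_Schwarz_ineq_sum)
  finally show ?thesis by (simp add: mult.commute)
qed

text \<open>The overshoot can make \<open>(1 + e)\<^sup>2 - |x + y|\<^sup>2\<close> negative only if \<open>|y| \<ge> e\<close>, and then the fourth power of \<open>|y|\<close> dominates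
  \<open>(1 + |y|)\<^sup>2\<close>. The margin \<open>e\<close> around the unit ball is what makes this constant finite.\<close>
lemma overshoot_bound:
  fixes x y :: "'a::real_inner"
  assumes e: "0 < e" and x: "norm x \<le> 1"
  shows "(if norm (x + y) \<le> 1 then (1 + e)\<^sup>2 - (norm (x + y))\<^sup>2 else 0)
    \<le> (1 + e)\<^sup>2 - (norm (x + y))\<^sup>2 + ((1 + e) / e\<^sup>2)\<^sup>2 * norm y ^ 4"
proof (cases "norm (x + y) \<le> 1 + e")
  case True
  then have "(norm (x + y))\<^sup>2 \<le> (1 + e)\<^sup>2" by (intro power_mono) auto
  then show ?thesis by auto
next
  case False
  have n: "norm (x + y) \<le> 1 + norm y" using norm_triangle_ineq[of x y] x by linarith
  then have y: "e \<le> norm y" using False by linarith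
  have "(1 + norm y) * e\<^sup>2 \<le> (1 + e) * (norm y)\<^sup>2"
  proof -
    have "e\<^sup>2 \<le> (norm y)\<^sup>2" using y e by (intro power_mono) auto
    moreover have "(norm y * e) * e \<le> (norm y * e) * norm y" using y e by (intro mult_left_mono) auto
    ultimately show ?thesis by (simp add: power2_eq_square algebra_simps)
  qed
  then have "1 + norm y \<le> (1 + e) / e\<^sup>2 * (norm y)\<^sup>2" using e by (simp add: field_simps)
  then have "norm (x + y) \<le> (1 + e) / e\<^sup>2 * (norm y)\<^sup>2" using n by linarith
  then have "(norm (x + y))\<^sup>2 \<le> ((1 + e) / e\<^sup>2 * (norm y)\<^sup>2)\<^sup>2" by (intro power_mono) auto
  also have "\<dots> = ((1 + e) / e\<^sup>2)\<^sup>2 * norm y ^ 4" by (simp only: power_mult_distrib power_mult[symmetric]) simp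
  finally have "(norm (x + y))\<^sup>2 \<le> ((1 + e) / e\<^sup>2)\<^sup>2 * norm y ^ 4" .
  moreover have "0 \<le> (1 + e)\<^sup>2" by simp
  moreover have "\<not> norm (x + y) \<le> 1" using False e by linarith
  ultimately show ?thesis by (simp only: if_False)
qed

text \<open>After \<open>overshoot_bound\<close> the integrand is a polynomial in the coordinates, whose mean is computed from the first, second and
  fourth moments: the linear term vanishes, the quadratic one yields \<open>n * s\<^sup>2\<close>, and the fourth power costs at most
  \<open>3 * n\<^sup>2 * K * s ^ 4\<close>.\<close>
lemma ball_exit_mean_step:
  fixes x :: "real ^ 'n"
  assumes e: "0 < e" and x: "norm x \<le> 1" and s: "0 \<le> s"
  defines "n \<equiv> real CARD('n)" and "K \<equiv> ((1 + e) / e\<^sup>2)\<^sup>2"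
  assumes \<kappa>: "\<kappa> = n * s\<^sup>2 - 3 * n\<^sup>2 * K * s ^ 4" "0 \<le> \<kappa>"
  shows "(\<integral>\<^sup>+ z. ennreal (if norm (x + s *\<^sub>R z) \<le> 1 then (1 + e)\<^sup>2 - (norm (x + s *\<^sub>R z))\<^sup>2 else 0) \<partial>std_gaussian_vec)
    + ennreal \<kappa> \<le> ennreal ((1 + e)\<^sup>2 - (norm x)\<^sup>2)"
proof -
  have K: "0 \<le> K" by (simp add: K_def)
  define f where "f z = ((1 + e)\<^sup>2 - (norm x)\<^sup>2) + (\<Sum>i\<in>UNIV. (- 2 * s * x $ i) * z $ i - s\<^sup>2 * (z $ i)\<^sup>2
      + (K * s ^ 4 * n) * (z $ i) ^ 4)" for z :: "real ^ 'n"
  interpret prob_space "std_gaussian_vec :: (real ^ 'n) measure" by (rule prob_space_std_gaussian_vec)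
  have f: "(if norm (x + s *\<^sub>R z) \<le> 1 then (1 + e)\<^sup>2 - (norm (x + s *\<^sub>R z))\<^sup>2 else 0) \<le> f z" for z
  proof -
    have "(norm (x + s *\<^sub>R z))\<^sup>2 = (norm x)\<^sup>2 + (\<Sum>i\<in>UNIV. 2 * s * x $ i * z $ i + s\<^sup>2 * (z $ i)\<^sup>2)"
      unfolding power2_norm_eq_inner inner_vec_def sum.distrib[symmetric]
      by (intro sum.cong refl) (simp add: power2_eq_square algebra_simps)
    moreover have "norm (s *\<^sub>R z) ^ 4 \<le> s ^ 4 * (n * (\<Sum>i\<in>UNIV. (z $ i) ^ 4))"
      unfolding n_def using norm_power4_le_sum[of z] s by (simp add: power_mult_distrib mult_left_mono)
    then have "K * norm (s *\<^sub>R z) ^ 4 \<le> (\<Sum>i\<in>UNIV. (K * s ^ 4 * n) * (z $ i) ^ 4)"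
      using K mult_left_mono[of "norm (s *\<^sub>R z) ^ 4" "s ^ 4 * (n * (\<Sum>i\<in>UNIV. (z $ i) ^ 4))" K]
      by (simp add: sum_distrib_left mult.assoc)
    moreover have "f z = (1 + e)\<^sup>2 - ((norm x)\<^sup>2 + (\<Sum>i\<in>UNIV. 2 * s * x $ i * z $ i + s\<^sup>2 * (z $ i)\<^sup>2))
       + (\<Sum>i\<in>UNIV. (K * s ^ 4 * n) * (z $ i) ^ 4)"
      unfolding f_def by (simp add: sum.distrib sum_subtractf sum_negf)
    ultimately have "(1 + e)\<^sup>2 - (norm (x + s *\<^sub>R z))\<^sup>2 + K * norm (s *\<^sub>R z) ^ 4 \<le> f z"
      by linarith
    with overshoot_bound[OF e x, of "s *\<^sub>R z", folded K_def] show ?thesis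
      by (rule order_trans)
  qed
  have g0: "0 \<le> (if norm (x + s *\<^sub>R z) \<le> 1 then (1 + e)\<^sup>2 - (norm (x + s *\<^sub>R z))\<^sup>2 else 0)" for z
  proof (cases "norm (x + s *\<^sub>R z) \<le> 1")
    case True
    then have "(norm (x + s *\<^sub>R z))\<^sup>2 \<le> (1 + e)\<^sup>2" using e by (intro power_mono) auto
    then show ?thesis by simp
  qed simp
  have f0: "0 \<le> f z" for z using f g0 order_trans by blast
  note int = std_gaussian_vec_moments(1)[of _ 1, simplified] std_gaussian_vec_moments(1)
  have intf: "integrable std_gaussian_vec f"
    unfolding f_def
    by (intro Bochner_Integration.integrable_add Bochner_Integration.integrable_diff
        Bochner_Integration.integrable_sum integrable_mult_right int integrable_const)
  have mean: "(LINT z|std_gaussian_vec. f z) = ((1 + e)\<^sup>2 - (norm x)\<^sup>2) - \<kappa>"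
  proof -
    have term_int: "integrable std_gaussian_vec (\<lambda>z. a * z $ i - b * (z $ i)\<^sup>2 + c * (z $ i) ^ 4)"
      for a b c and i :: 'n
      by (intro Bochner_Integration.integrable_add Bochner_Integration.integrable_diff
          integrable_mult_right int)
    have "(LINT z|std_gaussian_vec. a * z $ i - b * (z $ i)\<^sup>2 + c * (z $ i) ^ 4) = c * 3 - b"
      for a b c and i :: 'n
      by (subst Bochner_Integration.integral_add Bochner_Integration.integral_diff,
          intro Bochner_Integration.integrable_diff integrable_mult_right int,
          intro integrable_mult_right int,
          subst Bochner_Integration.integral_diff, intro integrable_mult_right int,
          intro integrable_mult_right int)
        (simp add: std_gaussian_vec_moments)
    note term_mean = this
    have "(LINT z|std_gaussian_vec. f z) = (LINT z|(std_gaussian_vec :: (real^'n) measure). (1 + e)\<^sup>2 - (norm x)\<^sup>2) +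
       (LINT z|std_gaussian_vec. (\<Sum>i\<in>UNIV. (- 2 * s * x $ i) * z $ i - s\<^sup>2 * (z $ i)\<^sup>2
      + (K * s ^ 4 * n) * (z $ i) ^ 4))"
      unfolding f_def
      by (rule Bochner_Integration.integral_add[OF integrable_const
            Bochner_Integration.integrable_sum[OF term_int]])
    also have "(LINT z|std_gaussian_vec. (\<Sum>i\<in>UNIV. (- 2 * s * x $ i) * z $ i - s\<^sup>2 * (z $ i)\<^sup>2
      + (K * s ^ 4 * n) * (z $ i) ^ 4)) = (\<Sum>i\<in>(UNIV::'n set). (K * s ^ 4 * n) * 3 - s\<^sup>2)"
      by (subst Bochner_Integration.integral_sum, rule term_int) (simp only: term_mean)
    also have "(LINT z|(std_gaussian_vec :: (real^'n) measure). (1 + e)\<^sup>2 - (norm x)\<^sup>2) = (1 + e)\<^sup>2 - (norm x)\<^sup>2"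
      by (simp add: prob_space)
    finally have "(LINT z|std_gaussian_vec. f z) = ((1 + e)\<^sup>2 - (norm x)\<^sup>2) +
       (\<Sum>i\<in>(UNIV::'n set). (K * s ^ 4 * n) * 3 - s\<^sup>2)" .
    then show ?thesis unfolding \<kappa> by (simp add: n_def[symmetric] power2_eq_square algebra_simps)
  qed
  then have "(\<integral>\<^sup>+ z. ennreal (f z) \<partial>std_gaussian_vec) = ennreal ((1 + e)\<^sup>2 - (norm x)\<^sup>2 - \<kappa>)"
    using nn_integral_eq_integral[OF intf] f0 by simp
  moreover have "0 \<le> (1 + e)\<^sup>2 - (norm x)\<^sup>2 - \<kappa>"
    using Bochner_Integration.integral_nonneg[of std_gaussian_vec f, OF f0] calculation(1) mean by simp
  moreover have "(\<integral>\<^sup>+ z. ennreal (if norm (x + s *\<^sub>R z) \<le> 1 then (1 + e)\<^sup>2 - (norm (x + s *\<^sub>R z))\<^sup>2 else 0) \<partial>std_gaussian_vec)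
      \<le> (\<integral>\<^sup>+ z. ennreal (f z) \<partial>std_gaussian_vec)"
    by (intro nn_integral_mono ennreal_leI f)
  ultimately have "(\<integral>\<^sup>+ z. ennreal (if norm (x + s *\<^sub>R z) \<le> 1 then (1 + e)\<^sup>2 - (norm (x + s *\<^sub>R z))\<^sup>2 else 0) \<partial>std_gaussian_vec)
    + ennreal \<kappa> \<le> ennreal ((1 + e)\<^sup>2 - (norm x)\<^sup>2 - \<kappa>) + ennreal \<kappa>"
    by (intro add_right_mono) simp
  also have "\<dots> = ennreal ((1 + e)\<^sup>2 - (norm x)\<^sup>2)"
    using \<kappa>(2) \<open>0 \<le> (1 + e)\<^sup>2 - (norm x)\<^sup>2 - \<kappa>\<close> by (subst ennreal_plus[symmetric]) auto
  finally show ?thesis .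
qed

definition stays_in_ball :: "real \<Rightarrow> nat \<Rightarrow> (nat \<Rightarrow> 'a::real_normed_vector) \<Rightarrow> bool" where
  "stays_in_ball s j x \<longleftrightarrow> (\<forall>i\<le>j. norm (s *\<^sub>R walk x i) \<le> 1)"

lemma stays_in_ball_Suc:
  "stays_in_ball s (Suc j) x \<longleftrightarrow> stays_in_ball s j x \<and> norm (s *\<^sub>R walk x (Suc j)) \<le> 1"
  unfolding stays_in_ball_def by (auto simp: le_Suc_eq)

lemma stays_in_ball_cong: "(\<And>i. i < j \<Longrightarrow> x i = y i) \<Longrightarrow> stays_in_ball s j x \<longleftrightarrow> stays_in_ball s j y"
proof -
  assume eq: "\<And>i. i < j \<Longrightarrow> x i = y i"
  have "walk x i = walk y i" if "i \<le> j" for i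
    using that by (intro walk_cong eq) auto
  then show ?thesis by (simp add: stays_in_ball_def)
qed

lemma measurable_stays_in_ball:
  fixes \<gamma> :: "'a::{second_countable_topology, real_normed_vector} measure"
  assumes "sets \<gamma> = sets borel"
  shows "Measurable.pred (PiM {..<j} (\<lambda>_. \<gamma>)) (stays_in_ball s j)"
proof -
  have "Measurable.pred (PiM {..<j} (\<lambda>_. \<gamma>)) (\<lambda>x. norm (s *\<^sub>R walk x i) \<le> 1)" if "i \<in> {..j}" for i
    using borel_measurable_walk[OF assms, of i j] that by simp
  then have "Measurable.pred (PiM {..<j} (\<lambda>_. \<gamma>)) (\<lambda>x. \<forall>i\<in>{..j}. norm (s *\<^sub>R walk x i) \<le> 1)"
    by (rule pred_intros_finite(3)[OF finite_atMost])
  moreover have "stays_in_ball s j = (\<lambda>x :: nat \<Rightarrow> 'a. \<forall>i\<in>{..j}. norm (s *\<^sub>R walk x i) \<le> 1)"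
    by (auto simp: stays_in_ball_def fun_eq_iff)
  ultimately show ?thesis by (simp only:)
qed

text \<open>As long as the walk has not left the ball, each step lowers the mean of \<open>(1 + e)\<^sup>2 - |S|\<^sup>2\<close> by \<open>\<kappa>\<close>, and this quantity starts at
  \<open>(1 + e)\<^sup>2\<close> and stays nonnegative inside the ball. So \<open>\<kappa>\<close> times the mean number of steps inside is at most \<open>(1 + e)\<^sup>2\<close>.\<close>
lemma sum_stay_probability_le:
  fixes e s \<kappa> :: real
  assumes e: "0 < e" and s: "0 \<le> s"
  defines "n \<equiv> real CARD('n)" and "K \<equiv> ((1 + e) / e\<^sup>2)\<^sup>2"
  assumes \<kappa>: "\<kappa> = n * s\<^sup>2 - 3 * n\<^sup>2 * K * s ^ 4" "0 \<le> \<kappa>"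
  defines "P \<equiv> \<lambda>m. PiM {..<m} (\<lambda>_::nat. std_gaussian_vec :: (real ^ 'n) measure)"
  shows "(\<Sum>j<m. ennreal \<kappa> * (\<integral>\<^sup>+ x. of_bool (stays_in_ball s j x) \<partial>P j))
    + (\<integral>\<^sup>+ x. of_bool (stays_in_ball s m x) * ennreal ((1 + e)\<^sup>2 - (norm (s *\<^sub>R walk x m))\<^sup>2) \<partial>P m)
    \<le> ennreal ((1 + e)\<^sup>2)"
proof (induction m)
  case 0
  have "prob_space (P 0)" unfolding P_def by (intro prob_space_PiM) auto
  then show ?case by (simp add: stays_in_ball_def prob_space.emeasure_space_1)
next
  case (Suc m)
  let ?\<gamma> = "std_gaussian_vec :: (real ^ 'n) measure"
  interpret product_sigma_finite "\<lambda>_::nat. ?\<gamma>"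
    by (intro product_sigma_finite.intro prob_space_imp_sigma_finite) auto
  let ?h = "\<lambda>m x. of_bool (stays_in_ball s m x) * ennreal ((1 + e)\<^sup>2 - (norm (s *\<^sub>R walk x m))\<^sup>2)"
  let ?g = "\<lambda>x z. ennreal (if norm (s *\<^sub>R walk x m + s *\<^sub>R z) \<le> 1
        then (1 + e)\<^sup>2 - (norm (s *\<^sub>R walk x m + s *\<^sub>R z))\<^sup>2 else 0)"
  have [measurable]: "Measurable.pred (P j) (stays_in_ball s j)" "(\<lambda>x. walk x j) \<in> borel_measurable (P j)" for j
    unfolding P_def by (intro measurable_stays_in_ball borel_measurable_walk; simp)+
  have hm: "?h (Suc m) \<in> borel_measurable (P (Suc m))" by measurable
  have gm: "(\<lambda>x. \<integral>\<^sup>+ z. ?g x z \<partial>?\<gamma>) \<in> borel_measurable (P m)"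
    by (intro sigma_finite_measure.borel_measurable_nn_integral prob_space_imp_sigma_finite) measurable
  have upd: "?h (Suc m) (x(m := z)) = of_bool (stays_in_ball s m x) * ?g x z" for x z
  proof -
    have "stays_in_ball s m (x(m := z)) \<longleftrightarrow> stays_in_ball s m x" by (rule stays_in_ball_cong) simp
    moreover have "walk (x(m := z)) m = walk x m" by (rule walk_cong) simp
    ultimately show ?thesis by (auto simp: stays_in_ball_Suc scaleR_add_right)
  qed
  have "(\<integral>\<^sup>+ x. ?h (Suc m) x \<partial>P (Suc m)) = (\<integral>\<^sup>+ x. \<integral>\<^sup>+ z. of_bool (stays_in_ball s m x) * ?g x z \<partial>?\<gamma> \<partial>P m)"
    using hm unfolding P_def lessThan_Suc by (subst product_nn_integral_insert) (simp_all only: upd, simp_all)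
  also have "\<dots> = (\<integral>\<^sup>+ x. of_bool (stays_in_ball s m x) * (\<integral>\<^sup>+ z. ?g x z \<partial>?\<gamma>) \<partial>P m)"
    by (intro nn_integral_cong nn_integral_cmult) measurable
  finally have "ennreal \<kappa> * (\<integral>\<^sup>+ x. of_bool (stays_in_ball s m x) \<partial>P m) + (\<integral>\<^sup>+ x. ?h (Suc m) x \<partial>P (Suc m))
    = (\<integral>\<^sup>+ x. ennreal \<kappa> * of_bool (stays_in_ball s m x)
         + of_bool (stays_in_ball s m x) * (\<integral>\<^sup>+ z. ?g x z \<partial>?\<gamma>) \<partial>P m)"
    using gm by (subst nn_integral_add) (auto simp: nn_integral_cmult)
  also have "\<dots> \<le> (\<integral>\<^sup>+ x. ?h m x \<partial>P m)"
  proof (intro nn_integral_mono)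
    fix x
    show "ennreal \<kappa> * of_bool (stays_in_ball s m x) + of_bool (stays_in_ball s m x) * (\<integral>\<^sup>+ z. ?g x z \<partial>?\<gamma>) \<le> ?h m x"
    proof (cases "stays_in_ball s m x")
      case True
      then have "norm (s *\<^sub>R walk x m) \<le> 1" by (auto simp: stays_in_ball_def)
      from ball_exit_mean_step[OF e this s, folded n_def, folded K_def, OF \<kappa>] True
      show ?thesis by (simp add: add.commute)
    qed simp
  qed
  finally show ?case
    using Suc.IH unfolding sum.lessThan_Suc add.assoc by (rule order_trans[OF add_left_mono])
qed

text \<open>Positions are measured from \<open>W 0\<close>, which equals \<open>0\<close> only almost surely; differences are what both the increments and the
  diameter see.\<close>
definition grid_stays ::
    "(real \<Rightarrow> 'w \<Rightarrow> 'a::real_normed_vector) \<Rightarrow> real \<Rightarrow> nat \<Rightarrow> 'w \<Rightarrow> bool" where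
  "grid_stays W d j \<omega> \<longleftrightarrow> (\<forall>i\<le>j. norm (W (real i * d) \<omega> - W 0 \<omega>) \<le> 1)"

context
  fixes M :: "'w measure" and W :: "real \<Rightarrow> 'w \<Rightarrow> real ^ 'n"
  assumes BM: "std_brownian_motion M W"
begin

interpretation prob_space M
  using BM by (simp add: std_brownian_motion_def std_brownian_motion_1d_def)

lemma grid_stays_probability:
  assumes d: "0 < d"
  shows "(\<integral>\<^sup>+ \<omega>. of_bool (grid_stays W d j \<omega>) \<partial>M)
    = (\<integral>\<^sup>+ x. of_bool (stays_in_ball (sqrt d) j x) \<partial>PiM {..<j} (\<lambda>_. std_gaussian_vec :: (real ^ 'n) measure))"
proof (cases "j = 0")
  case True
  have "prob_space (PiM {..<0} (\<lambda>_::nat. std_gaussian_vec :: (real ^ 'n) measure))"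
    by (intro prob_space_PiM) auto
  then show ?thesis unfolding True
    by (simp add: grid_stays_def stays_in_ball_def prob_space.emeasure_space_1 emeasure_space_1)
next
  case False
  have [measurable]: "grid_increments W d j \<in> M \<rightarrow>\<^sub>M PiM {..<j} (\<lambda>_. borel)"
    unfolding grid_increments_def[abs_def] using d
    by (intro measurable_restrict borel_measurable_scaleR borel_measurable_diff
        std_brownian_motion_measurable[OF BM]) auto
  have [measurable]: "Measurable.pred (PiM {..<j} (\<lambda>_. borel :: (real^'n) measure)) (stays_in_ball (sqrt d) j)"
    by (rule measurable_stays_in_ball) simp
  have "grid_stays W d j \<omega> \<longleftrightarrow> stays_in_ball (sqrt d) j (grid_increments W d j \<omega>)" for \<omega>
    using walk_grid_increments[OF d, of _ j W \<omega>] by (auto simp: grid_stays_def stays_in_ball_def)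
  then have "(\<integral>\<^sup>+ \<omega>. of_bool (grid_stays W d j \<omega>) \<partial>M) =
      (\<integral>\<^sup>+ \<omega>. of_bool (stays_in_ball (sqrt d) j (grid_increments W d j \<omega>)) \<partial>M)"
    by (simp only:)
  also have "\<dots> = (\<integral>\<^sup>+ x. of_bool (stays_in_ball (sqrt d) j x) \<partial>distr M (PiM {..<j} (\<lambda>_. borel)) (grid_increments W d j))"
    by (rule nn_integral_distr[symmetric]) measurable
  finally show ?thesis
    using distr_vector_grid_increments[OF BM d] False by simp
qed

lemma sum_grid_stays_le:
  assumes e: "0 < e" and d: "0 < d"
  defines "n \<equiv> real CARD('n)" and "K \<equiv> ((1 + e) / e\<^sup>2)\<^sup>2"
  assumes small: "3 * n * K * d < 1"
  shows "(\<Sum>j<m. ennreal d * (\<integral>\<^sup>+ \<omega>. of_bool (grid_stays W d j \<omega>) \<partial>M))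
    \<le> ennreal ((1 + e)\<^sup>2 / (n - 3 * n\<^sup>2 * K * d))"
proof -
  define \<kappa> where "\<kappa> = n * (sqrt d)\<^sup>2 - 3 * n\<^sup>2 * K * sqrt d ^ 4"
  define c where "c = n - 3 * n\<^sup>2 * K * d"
  have n: "0 < n" by (simp add: n_def)
  have c: "0 < c"
  proof -
    have "c = n * (1 - 3 * n * K * d)" by (simp add: c_def power2_eq_square algebra_simps)
    then show ?thesis using n small by simp
  qed
  have "sqrt d ^ 4 = ((sqrt d)\<^sup>2)\<^sup>2" by (simp flip: power_mult)
  then have "sqrt d ^ 4 = d\<^sup>2" using d by simp
  then have \<kappa>: "\<kappa> = c * d" using d by (simp add: \<kappa>_def c_def power2_eq_square algebra_simps)
  have \<kappa>': "\<kappa> = real CARD('n) * (sqrt d)\<^sup>2 - 3 * (real CARD('n))\<^sup>2 * ((1 + e) / e\<^sup>2)\<^sup>2 * sqrt d ^ 4"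
    by (simp only: \<kappa>_def n_def K_def)
  have "0 \<le> \<kappa>" "0 \<le> sqrt d" using \<kappa> c d by simp_all
  note bound = sum_stay_probability_le[OF e this(2) \<kappa>' this(1), of m]
  let ?p = "\<lambda>j. \<integral>\<^sup>+ \<omega>. of_bool (grid_stays W d j \<omega>) \<partial>M"
  have "(\<Sum>j<m. ennreal \<kappa> * ?p j) \<le> ennreal ((1 + e)\<^sup>2)"
    unfolding grid_stays_probability[OF d]
    by (rule order_trans[OF _ bound]) simp
  then have "ennreal (1 / c) * (\<Sum>j<m. ennreal \<kappa> * ?p j) \<le> ennreal (1 / c) * ennreal ((1 + e)\<^sup>2)"
    by (rule mult_left_mono) simp
  also have "\<dots> = ennreal ((1 + e)\<^sup>2 / c)"
    using c by (simp add: ennreal_mult'[symmetric])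
  also have "ennreal (1 / c) * (\<Sum>j<m. ennreal \<kappa> * ?p j) = (\<Sum>j<m. (ennreal (1 / c) * ennreal \<kappa>) * ?p j)"
    by (simp only: sum_distrib_left mult.assoc)
  also have "ennreal (1 / c) * ennreal \<kappa> = ennreal d"
    using c d by (simp add: \<kappa> ennreal_mult'[symmetric])
  finally show ?thesis by (simp only: c_def)
qed

end

section \<open>The hull of a continuous path and its values on grids\<close>

text \<open>Passing to the convex hull does not enlarge the diameter, because balls are convex: \<open>S\<close> lies in the ball of radius \<open>c\<close>
  around each of its points, so the hull does, and by symmetry \<open>S\<close> and then the hull lie in the ball of radius \<open>c\<close>
  around each point of the hull.\<close>
lemma diameter_convex_hull_le:
  fixes S :: "'a::real_normed_vector set"
  assumes "0 \<le> c" and S: "\<And>x y. x \<in> S \<Longrightarrow> y \<in> S \<Longrightarrow> dist x y \<le> c"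
  shows "diameter (convex hull S) \<le> c"
proof (rule diameter_le)
  show "convex hull S \<noteq> {} \<or> 0 \<le> c" using assms by blast
  fix x y assume x: "x \<in> convex hull S" and y: "y \<in> convex hull S"
  have hull: "convex hull S \<subseteq> cball z c" if "z \<in> S" for z
    using S that by (intro hull_minimal convex_cball) auto
  have "S \<subseteq> cball x c"
  proof
    fix z assume z: "z \<in> S"
    from hull[OF this] x show "z \<in> cball x c" by (auto simp: dist_commute)
  qed
  then have "convex hull S \<subseteq> cball x c" by (intro hull_minimal convex_cball)
  then show "norm (x - y) \<le> c" using y by (auto simp: dist_norm)
qed

text \<open>Rounding two times down to finer and finer grids, the positions on the grids converge by continuity, and the bound on their
  distance survives in the limit.\<close>
lemma diameter_path_hull_le_of_dyadic_grids:
  assumes cont: "continuous_on {0..} (\<lambda>s. W s \<omega>)" and t: "0 < t" and y: "0 \<le> y"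
    and grid: "\<And>k. seq_diam (\<lambda>j. W (real j * (t / 2 ^ k)) \<omega>) (2 ^ k) \<le> y"
  shows "diameter (path_hull W t \<omega>) \<le> y"
  unfolding path_hull_def
proof (rule diameter_convex_hull_le[OF y])
  define a where "a s k = nat \<lfloor>s * 2 ^ k / t\<rfloor>" for s :: real and k :: nat
  have a: "a s k \<le> 2 ^ k" "\<bar>real (a s k) * (t / 2 ^ k) - s\<bar> \<le> t * (1 / 2) ^ k" if "0 \<le> s" "s \<le> t" for s k
  proof -
    have r: "real (a s k) = of_int \<lfloor>s * 2 ^ k / t\<rfloor>" using that t by (simp add: a_def)
    have le: "real (a s k) \<le> s * 2 ^ k / t" and gt: "s * 2 ^ k / t < real (a s k) + 1"
      unfolding r by linarith+
    have "s * 2 ^ k / t \<le> 2 ^ k" using that t by (simp add: field_simps)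
    with le have "real (a s k) \<le> 2 ^ k" by (rule order_trans)
    then have "real (a s k) \<le> real (2 ^ k)" by (simp only: of_nat_power of_nat_numeral)
    then show "a s k \<le> 2 ^ k" by (simp only: of_nat_le_iff)
    have "\<bar>real (a s k) - s * 2 ^ k / t\<bar> \<le> 1" using le gt by simp
    then have "\<bar>real (a s k) - s * 2 ^ k / t\<bar> * (t / 2 ^ k) \<le> 1 * (t / 2 ^ k)"
      using t by (intro mult_right_mono) auto
    moreover have "real (a s k) * (t / 2 ^ k) - s = (real (a s k) - s * 2 ^ k / t) * (t / 2 ^ k)"
      using t by (simp add: field_simps)
    ultimately show "\<bar>real (a s k) * (t / 2 ^ k) - s\<bar> \<le> t * (1 / 2) ^ k"
      using t by (simp add: abs_mult power_one_over)
  qed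
  have lim: "(\<lambda>k. W (real (a s k) * (t / 2 ^ k)) \<omega>) \<longlonglongrightarrow> W s \<omega>" if s: "0 \<le> s" "s \<le> t" for s
  proof -
    have "(\<lambda>k. t * (1 / 2) ^ k) \<longlonglongrightarrow> 0"
      by (rule tendsto_mult_right_zero[OF LIMSEQ_power_zero]) simp
    then have "(\<lambda>k. real (a s k) * (t / 2 ^ k) - s) \<longlonglongrightarrow> 0"
      by (rule Lim_null_comparison[rotated]) (use a(2)[OF s] in auto)
    then have "(\<lambda>k. real (a s k) * (t / 2 ^ k)) \<longlonglongrightarrow> s" by (simp only: LIM_zero_iff)
    then show ?thesis
      by (rule continuous_on_tendsto_compose[OF cont]) (use s t in auto)
  qed
  fix p q assume "p \<in> (\<lambda>s. W s \<omega>) ` {0..t}" "q \<in> (\<lambda>s. W s \<omega>) ` {0..t}"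
  then obtain s u where s: "0 \<le> s" "s \<le> t" "p = W s \<omega>" and u: "0 \<le> u" "u \<le> t" "q = W u \<omega>"
    by auto
  have "dist (W (real (a s k) * (t / 2 ^ k)) \<omega>) (W (real (a u k) * (t / 2 ^ k)) \<omega>) \<le> y" for k
    using dist_le_seq_diam[OF a(1)[OF s(1,2)] a(1)[OF u(1,2)], where f = "\<lambda>j. W (real j * (t / 2 ^ k)) \<omega>"]
      grid[of k] by (rule order_trans)
  then show "dist p q \<le> y"
    unfolding s u
    by (intro tendsto_upperbound[OF tendsto_dist[OF lim[OF s(1,2)] lim[OF u(1,2)]]]) auto
qed

lemma bounded_path_hull:
  fixes W :: "real \<Rightarrow> 'w \<Rightarrow> real ^ 'n"
  assumes "continuous_on {0..} (\<lambda>s. W s \<omega>)"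
  shows "bounded (path_hull W t \<omega>)"
  unfolding path_hull_def
  by (intro bounded_convex_hull compact_imp_bounded compact_continuous_image
      continuous_on_subset[OF assms]) auto

lemma dist_le_diameter_path_hull:
  fixes W :: "real \<Rightarrow> 'w \<Rightarrow> real ^ 'n"
  assumes "continuous_on {0..} (\<lambda>s. W s \<omega>)" "s \<in> {0..t}" "u \<in> {0..t}"
  shows "dist (W s \<omega>) (W u \<omega>) \<le> diameter (path_hull W t \<omega>)"
  using assms(2,3) by (intro diameter_bounded_bound bounded_path_hull assms(1))
    (auto simp: path_hull_def intro!: hull_inc)

lemma diameter_path_hull_mono:
  fixes W :: "real \<Rightarrow> 'w \<Rightarrow> real ^ 'n"
  assumes "continuous_on {0..} (\<lambda>s. W s \<omega>)" "t \<le> u"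
  shows "diameter (path_hull W t \<omega>) \<le> diameter (path_hull W u \<omega>)"
  using assms(2) by (intro diameter_subset bounded_path_hull assms(1))
    (auto simp: path_hull_def intro!: hull_mono)

text \<open>The right-hand side is \<open>d\<close> times the number of grid times before the exit from the unit ball, i.e. the exit time on the
  grid; at that time the diameter exceeds \<open>1\<close>. If there is no exit, the sum diverges.\<close>
lemma inverse_diameter_le_sum_grid_stays:
  fixes W :: "real \<Rightarrow> 'w \<Rightarrow> real ^ 'n"
  assumes cont: "continuous_on {0..} (\<lambda>s. W s \<omega>)" and d: "0 < d"
  shows "inverse_diameter W 1 \<omega> \<le> (\<Sum>j. ennreal d * of_bool (grid_stays W d j \<omega>))"
proof (cases "\<forall>j. grid_stays W d j \<omega>")
  case True
  have "(\<Sum>j. ennreal d * of_bool (grid_stays W d j \<omega>)) = \<top>"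
  proof -
    have "ennreal (real m * d) \<le> (\<Sum>j. ennreal d * of_bool (grid_stays W d j \<omega>))" for m
    proof -
      have "ennreal (real m * d) = (\<Sum>j<m. ennreal d * of_bool (grid_stays W d j \<omega>))"
        using True d by (simp add: ennreal_mult' ennreal_of_nat_eq_real_of_nat)
      also have "\<dots> \<le> (\<Sum>j. ennreal d * of_bool (grid_stays W d j \<omega>))"
        by (rule sum_le_suminf) auto
      finally show ?thesis .
    qed
    note big = this
    show ?thesis
    proof (rule ccontr)
      assume "(\<Sum>j. ennreal d * of_bool (grid_stays W d j \<omega>)) \<noteq> \<top>"
      then obtain r where r: "0 \<le> r" "(\<Sum>j. ennreal d * of_bool (grid_stays W d j \<omega>)) = ennreal r"
        by (cases "(\<Sum>j. ennreal d * of_bool (grid_stays W d j \<omega>))") auto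
      obtain m where "r < real m * d" using ex_less_of_nat_mult[OF d] by blast
      moreover have "real m * d \<le> r" using big[of m] r by simp
      ultimately show False by simp
    qed
  qed
  then show ?thesis by simp
next
  case False
  define m where "m = (LEAST j. \<not> grid_stays W d j \<omega>)"
  have m: "\<not> grid_stays W d m \<omega>" "\<And>j. j < m \<Longrightarrow> grid_stays W d j \<omega>"
    unfolding m_def using False LeastI_ex[of "\<lambda>j. \<not> grid_stays W d j \<omega>"] not_less_Least by blast+
  then obtain i where i: "i \<le> m" "1 < norm (W (real i * d) \<omega> - W 0 \<omega>)"
    by (auto simp: grid_stays_def not_le)
  have "1 < diameter (path_hull W (real m * d) \<omega>)"
    using i d dist_le_diameter_path_hull[where W = W and \<omega> = \<omega>
        and s = "real i * d" and t = "real m * d" and u = 0] cont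
    by (simp add: dist_norm mult_right_mono)
  then have "inverse_diameter W 1 \<omega> \<le> ennreal (real m * d)"
    unfolding inverse_diameter_def using d by (intro Inf_lower) auto
  also have "\<dots> = (\<Sum>j<m. ennreal d * of_bool (grid_stays W d j \<omega>))"
    using m(2) d by (simp add: ennreal_mult' ennreal_of_nat_eq_real_of_nat)
  also have "\<dots> \<le> (\<Sum>j. ennreal d * of_bool (grid_stays W d j \<omega>))"
    by (rule sum_le_suminf) auto
  finally show ?thesis .
qed

definition dyadic_diam_le ::
    "(real \<Rightarrow> 'w \<Rightarrow> 'a::metric_space) \<Rightarrow> real \<Rightarrow> nat \<Rightarrow> 'w \<Rightarrow> bool" where
  "dyadic_diam_le W t k \<omega> \<longleftrightarrow> seq_diam (\<lambda>j. W (real j * (t / 2 ^ k)) \<omega>) (2 ^ k) \<le> 1"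

text \<open>A lower Riemann sum for \<open>\<Theta> = \<integral> 1{D t \<le> 1} dt\<close>. Since the sum runs over finitely many times, only measurability in the path is at stake, and the condition
  \<open>D t \<le> 1\<close> is expressed through dyadic grids, where it is a countable intersection of events.\<close>
lemma sum_dyadic_diam_le_inverse_diameter:
  fixes W :: "real \<Rightarrow> 'w \<Rightarrow> real ^ 'n"
  assumes cont: "continuous_on {0..} (\<lambda>s. W s \<omega>)" and d: "0 < d"
  shows "(\<Sum>j\<in>{1..m}. ennreal d * of_bool (\<forall>k. dyadic_diam_le W (real j * d) k \<omega>))
    \<le> inverse_diameter W 1 \<omega>"
  unfolding inverse_diameter_def
proof (rule Inf_greatest)
  fix \<tau> assume "\<tau> \<in> {ennreal t |t. 0 \<le> t \<and> 1 < diameter (path_hull W t \<omega>)}"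
  then obtain t where t: "\<tau> = ennreal t" "0 \<le> t" "1 < diameter (path_hull W t \<omega>)" by auto
  let ?A = "{j\<in>{1..m}. \<forall>k. dyadic_diam_le W (real j * d) k \<omega>}"
  \<comment> \<open>The times counted by \<open>?A\<close> precede every time at which the diameter exceeds \<open>1\<close>.\<close>
  have lt: "real j * d < t" if "j \<in> ?A" for j
  proof (rule ccontr)
    assume "\<not> real j * d < t"
    then have "diameter (path_hull W t \<omega>) \<le> diameter (path_hull W (real j * d) \<omega>)"
      by (intro diameter_path_hull_mono cont) simp
    also have "\<dots> \<le> 1"
      using that d by (intro diameter_path_hull_le_of_dyadic_grids cont) (auto simp: dyadic_diam_le_def)
    finally show False using t by simp
  qed
  have "(\<Sum>j\<in>{1..m}. ennreal d * of_bool (\<forall>k. dyadic_diam_le W (real j * d) k \<omega>)) = (\<Sum>j\<in>?A. ennreal d)"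
    by (rule sum.mono_neutral_cong_right) auto
  also have "\<dots> = ennreal (real (card ?A) * d)"
    using d by (simp add: ennreal_mult' ennreal_of_nat_eq_real_of_nat)
  also have "\<dots> \<le> ennreal t"
  proof (cases "?A = {}")
    case False
    then have "Max ?A \<in> ?A" by (intro Max_in) auto
    \<comment> \<open>The indices start at \<open>1\<close>, so there are at most as many of them as the largest one.\<close>
    have "?A \<subseteq> {1..Max ?A}" by (auto intro!: Max_ge)
    then have "card ?A \<le> Max ?A" using card_mono[of "{1..Max ?A}" ?A] by simp
    then have "real (card ?A) * d \<le> real (Max ?A) * d" using d by simp
    also have "\<dots> < t" using lt[OF \<open>Max ?A \<in> ?A\<close>] .
    finally show ?thesis by (intro ennreal_leI) simp
  next
    case True
    then show ?thesis using t by (simp only: card.empty of_nat_0 mult_zero_left ennreal_0 zero_le)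
  qed
  finally show "(\<Sum>j\<in>{1..m}. ennreal d * of_bool (\<forall>k. dyadic_diam_le W (real j * d) k \<omega>)) \<le> \<tau>"
    unfolding t .
qed

lemma seq_diam_sq_le_sum_components:
  fixes f :: "nat \<Rightarrow> real ^ 'n"
  shows "(seq_diam f N)\<^sup>2 \<le> (\<Sum>i\<in>UNIV. (seq_diam (\<lambda>j. f j $ i) N)\<^sup>2)"
proof -
  obtain j k where jk: "j \<le> N" "k \<le> N" "seq_diam f N = dist (f j) (f k)"
    by (rule seq_diam_attained)
  have "(dist (f j) (f k))\<^sup>2 = (\<Sum>i\<in>UNIV. (dist (f j $ i) (f k $ i))\<^sup>2)"
    by (simp add: dist_vec_def L2_set_def sum_nonneg)
  also have "\<dots> \<le> (\<Sum>i\<in>UNIV. (seq_diam (\<lambda>j. f j $ i) N)\<^sup>2)"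
    using jk by (intro sum_mono power_mono dist_le_seq_diam[where f = "\<lambda>j. f j $ _"]) auto
  finally show ?thesis by (simp add: jk)
qed

lemma seq_diam_dyadic_mono:
  "seq_diam (\<lambda>j. f (real j * (t / 2 ^ k))) (2 ^ k) \<le> seq_diam (\<lambda>j. f (real j * (t / 2 ^ Suc k))) (2 ^ Suc k)"
  unfolding seq_diam_le_iff
proof (intro allI impI)
  fix j l :: nat assume "j \<le> 2 ^ k" "l \<le> 2 ^ k"
  then have "2 * j \<le> 2 ^ Suc k" "2 * l \<le> 2 ^ Suc k" by auto
  from dist_le_seq_diam[OF this, of "\<lambda>j. f (real j * (t / 2 ^ Suc k))"]
  show "dist (f (real j * (t / 2 ^ k))) (f (real l * (t / 2 ^ k)))
    \<le> seq_diam (\<lambda>j. f (real j * (t / 2 ^ Suc k))) (2 ^ Suc k)" by simp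
qed

text \<open>Jensen's inequality in its tangent form \<open>1 / x \<ge> 2 / c - x / c\<^sup>2\<close>, with the Riemann sum in place of \<open>1 / x\<close>: among
  the multiples of \<open>d\<close>, those up to \<open>1 / x\<close> contribute at least \<open>1 / x - d\<close>. Finitely many terms suffice because
  only the size \<open>2 / c\<close> has to be reached.\<close>
lemma two_over_le_grid_sum:
  fixes \<Delta> :: ennreal
  assumes c: "0 < c" and d: "0 < d" and m: "2 / c \<le> real m * d"
  shows "ennreal (2 / c) \<le> (\<Sum>j\<in>{1..m}. ennreal d * of_bool (ennreal (real j * d) * \<Delta> \<le> 1))
    + ennreal (1 / c\<^sup>2) * \<Delta> + ennreal d"
proof (cases \<Delta>)
  case (real x)
  \<comment> \<open>For infinite \<open>\<Delta>\<close> the right-hand side is infinite; in the present case \<open>\<Delta>\<close> is a real number \<open>x\<close>.\<close>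
  have eq: "ennreal (real j * d) * \<Delta> \<le> 1 \<longleftrightarrow> real j * d * x \<le> 1" for j
    using d real by (simp add: ennreal_mult'[symmetric] ennreal_le_1)
  have lower: "ennreal (real J * d) \<le> (\<Sum>j\<in>{1..m}. ennreal d * of_bool (ennreal (real j * d) * \<Delta> \<le> 1))"
    if "J \<le> m" "real J * d * x \<le> 1" for J
  proof -
    have small: "real j * d * x \<le> 1" if "j \<le> J" for j
    proof -
      have "real j * d * x \<le> real J * d * x" using that d real by (intro mult_right_mono) auto
      then show ?thesis using \<open>real J * d * x \<le> 1\<close> by simp
    qed
    have "ennreal (real J * d) = (\<Sum>j\<in>{1..J}. ennreal d * of_bool (ennreal (real j * d) * \<Delta> \<le> 1))"
      unfolding eq using small d by (simp add: ennreal_mult' ennreal_of_nat_eq_real_of_nat)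
    also have "\<dots> \<le> (\<Sum>j\<in>{1..m}. ennreal d * of_bool (ennreal (real j * d) * \<Delta> \<le> 1))"
      using that by (intro sum_mono2) auto
    finally show ?thesis .
  qed
  show ?thesis
  proof (cases "real m * d * x \<le> 1")
    case True
    have "ennreal (2 / c) \<le> ennreal (real m * d)" using m by (rule ennreal_leI)
    also have "\<dots> \<le> (\<Sum>j\<in>{1..m}. ennreal d * of_bool (ennreal (real j * d) * \<Delta> \<le> 1))"
      using True by (intro lower) auto
    finally show ?thesis by (simp add: add_increasing2)
  next
    case False
    then have x: "0 < x" using real by (cases "x = 0") auto
    \<comment> \<open>The number of positive multiples of \<open>d\<close> up to \<open>1 / x\<close>.\<close>
    define J where "J = nat \<lfloor>1 / (d * x)\<rfloor>"
    have r: "real J = of_int \<lfloor>1 / (d * x)\<rfloor>" using d x by (simp add: J_def)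
    have J: "real J \<le> 1 / (d * x)" "1 / (d * x) < real J + 1" unfolding r by linarith+
    have J1: "real J * d * x \<le> 1" using J(1) d x by (simp add: field_simps)
    have "1 / (d * x) < real m" using False d x by (simp add: field_simps)
    then have "J \<le> m" using J(1) by simp
    have "2 / c \<le> 1 / x + 1 / c\<^sup>2 * x"
    proof -
      have "0 \<le> (c - x)\<^sup>2 / (c\<^sup>2 * x)" using c x by simp
      also have "(c - x)\<^sup>2 / (c\<^sup>2 * x) = 1 / x + 1 / c\<^sup>2 * x - 2 / c"
        using c x by (simp add: field_simps power2_eq_square)
      finally show ?thesis by simp
    qed
    also have "1 / x \<le> real J * d + d" using J(2) d x by (simp add: field_simps)
    finally have "ennreal (2 / c) \<le> ennreal (real J * d + d + 1 / c\<^sup>2 * x)" by (intro ennreal_leI) simp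
    also have "\<dots> = ennreal (real J * d) + ennreal (1 / c\<^sup>2) * \<Delta> + ennreal d"
    proof -
      have "ennreal (1 / c\<^sup>2) * \<Delta> = ennreal (1 / c\<^sup>2 * x)"
        unfolding real by (rule ennreal_mult'[symmetric]) simp
      then show ?thesis using d x by (simp add: add_ac flip: ennreal_plus)
    qed
    also have "\<dots> \<le> (\<Sum>j\<in>{1..m}. ennreal d * of_bool (ennreal (real j * d) * \<Delta> \<le> 1))
      + ennreal (1 / c\<^sup>2) * \<Delta> + ennreal d"
      by (intro add_right_mono lower \<open>J \<le> m\<close> J1)
    finally show ?thesis .
  qed
next
  case top
  then show ?thesis using c by (simp add: ennreal_mult_top)
qed

section \<open>The two bounds\<close>

context
  fixes M :: "'w measure" and W :: "real \<Rightarrow> 'w \<Rightarrow> real ^ 'n"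
  assumes BM: "std_brownian_motion M W"
begin

interpretation prob_space M
  using BM by (simp add: std_brownian_motion_def std_brownian_motion_1d_def)

lemma AE_continuous_paths: "AE \<omega> in M. continuous_on {0..} (\<lambda>t. W t \<omega>)"
proof -
  have "AE \<omega> in M. continuous_on {0..} (\<lambda>t. W t \<omega> $ i)" for i
    using coordinate_brownian_motion[OF BM, of i] by (simp add: std_brownian_motion_1d_def)
  then have "AE \<omega> in M. \<forall>i. continuous_on {0..} (\<lambda>t. W t \<omega> $ i)"
    by (subst AE_all_countable) simp
  then show ?thesis
  proof eventually_elim
    case (elim \<omega>)
    then have "continuous_on {0..} (\<lambda>t. \<chi> i. W t \<omega> $ i)"
      by (intro continuous_on_vec_lambda) simp
    then show ?case by simp
  qed
qed

lemma borel_measurable_grid_diam: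
  "0 \<le> t \<Longrightarrow> (\<lambda>\<omega>. seq_diam (\<lambda>j. W (real j * t) \<omega>) N) \<in> borel_measurable M"
  by (intro borel_measurable_seq_diam std_brownian_motion_measurable[OF BM]) simp

lemma pred_grid_stays: "0 \<le> d \<Longrightarrow> Measurable.pred M (grid_stays W d j)"
proof -
  assume d: "0 \<le> d"
  have "Measurable.pred M (\<lambda>\<omega>. norm (W (real i * d) \<omega> - W 0 \<omega>) \<le> 1)" for i
    using std_brownian_motion_measurable[OF BM, of "real i * d"] d
      std_brownian_motion_measurable[OF BM, of 0] by simp
  then have "Measurable.pred M (\<lambda>\<omega>. \<forall>i\<in>{..j}. norm (W (real i * d) \<omega> - W 0 \<omega>) \<le> 1)"
    by (rule pred_intros_finite(3)[OF finite_atMost])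
  moreover have "grid_stays W d j = (\<lambda>\<omega>. \<forall>i\<in>{..j}. norm (W (real i * d) \<omega> - W 0 \<omega>) \<le> 1)"
    by (auto simp: grid_stays_def fun_eq_iff)
  ultimately show ?thesis by (simp only:)
qed

text \<open>The mesh \<open>d\<close> is sent to \<open>0\<close> for a fixed margin \<open>e\<close>, whose constant \<open>K e\<close> blows up as \<open>e\<close> vanishes; only then is \<open>e\<close> sent to \<open>0\<close>.\<close>
lemma inverse_diameter_upper:
  "(\<integral>\<^sup>+ \<omega>. inverse_diameter W 1 \<omega> \<partial>M) \<le> ennreal (1 / real CARD('n))"
proof -
  let ?n = "real CARD('n)"
  define K where "K e = ((1 + e) / e\<^sup>2)\<^sup>2" for e :: real
  have grid: "(\<integral>\<^sup>+ \<omega>. inverse_diameter W 1 \<omega> \<partial>M) \<le> ennreal ((1 + e)\<^sup>2 / (?n - 3 * ?n\<^sup>2 * K e * d))"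
    if e: "0 < e" and d: "0 < d" and small: "3 * ?n * K e * d < 1" for e d
  proof -
    have [measurable]: "Measurable.pred M (grid_stays W d j)" for j
      using d by (intro pred_grid_stays) simp
    have "(\<integral>\<^sup>+ \<omega>. inverse_diameter W 1 \<omega> \<partial>M)
      \<le> (\<integral>\<^sup>+ \<omega>. (\<Sum>j. ennreal d * of_bool (grid_stays W d j \<omega>)) \<partial>M)"
      by (intro nn_integral_mono_AE eventually_mono[OF AE_continuous_paths]
          inverse_diameter_le_sum_grid_stays d)
    also have "\<dots> = (\<Sum>j. \<integral>\<^sup>+ \<omega>. ennreal d * of_bool (grid_stays W d j \<omega>) \<partial>M)"
      by (intro nn_integral_suminf) measurable
    also have "\<dots> = (\<Sum>j. ennreal d * (\<integral>\<^sup>+ \<omega>. of_bool (grid_stays W d j \<omega>) \<partial>M))"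
      by (intro suminf_cong nn_integral_cmult) measurable
    also have "\<dots> \<le> ennreal ((1 + e)\<^sup>2 / (?n - 3 * ?n\<^sup>2 * K e * d))"
      unfolding suminf_eq_SUP K_def
      by (intro SUP_least sum_grid_stays_le[OF BM e d small[unfolded K_def]])
    finally show ?thesis .
  qed
  have fine: "(\<integral>\<^sup>+ \<omega>. inverse_diameter W 1 \<omega> \<partial>M) \<le> ennreal ((1 + e)\<^sup>2 / ?n)" if e: "0 < e" for e
  proof -
    have "((\<lambda>d. (1 + e)\<^sup>2 / (?n - 3 * ?n\<^sup>2 * K e * d)) \<longlongrightarrow> (1 + e)\<^sup>2 / (?n - 3 * ?n\<^sup>2 * K e * 0)) (at_right 0)"
      by (intro tendsto_intros) auto
    then have "((\<lambda>d. ennreal ((1 + e)\<^sup>2 / (?n - 3 * ?n\<^sup>2 * K e * d))) \<longlongrightarrow> ennreal ((1 + e)\<^sup>2 / ?n)) (at_right 0)"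
      by (intro tendsto_ennrealI) simp
    moreover have "\<forall>\<^sub>F d in at_right 0. 3 * ?n * K e * d < 1"
    proof -
      have "((\<lambda>d. 3 * ?n * K e * d) \<longlongrightarrow> 3 * ?n * K e * 0) (at_right 0)"
        by (intro tendsto_intros)
      then show ?thesis by (rule order_tendstoD(2)) simp
    qed
    then have "\<forall>\<^sub>F d in at_right 0. (\<integral>\<^sup>+ \<omega>. inverse_diameter W 1 \<omega> \<partial>M)
       \<le> ennreal ((1 + e)\<^sup>2 / (?n - 3 * ?n\<^sup>2 * K e * d))"
      using eventually_at_right_less[of 0] by eventually_elim (rule grid[OF e])
    ultimately show ?thesis by (rule tendsto_lowerbound) simp
  qed
  have "((\<lambda>e. (1 + e)\<^sup>2 / ?n) \<longlongrightarrow> (1 + 0)\<^sup>2 / ?n) (at_right (0::real))"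
    by (intro tendsto_intros) auto
  then have "((\<lambda>e. ennreal ((1 + e)\<^sup>2 / ?n)) \<longlongrightarrow> ennreal (1 / ?n)) (at_right (0::real))"
    by (intro tendsto_ennrealI) simp
  moreover have "\<forall>\<^sub>F e in at_right 0. (\<integral>\<^sup>+ \<omega>. inverse_diameter W 1 \<omega> \<partial>M) \<le> ennreal ((1 + e)\<^sup>2 / ?n)"
    using eventually_at_right_less[of "0::real"] by (rule eventually_mono) (rule fine)
  ultimately show ?thesis by (rule tendsto_lowerbound) simp
qed

definition unit_diam_sq :: "nat \<Rightarrow> 'w \<Rightarrow> ennreal" where
  "unit_diam_sq k \<omega> = ennreal ((seq_diam (\<lambda>j. W (real j * (1 / 2 ^ k)) \<omega>) (2 ^ k))\<^sup>2)"

lemma measurable_unit_diam_sq [measurable]: "unit_diam_sq k \<in> borel_measurable M"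
  unfolding unit_diam_sq_def[abs_def]
  by (intro measurable_compose[OF _ measurable_ennreal] borel_measurable_power borel_measurable_grid_diam) simp

text \<open>On each dyadic grid the squared diameter is at most the sum of the squared ranges of the coordinates; monotone convergence
  passes to the supremum over all grids.\<close>
lemma mean_unit_diam_sq_le: "(\<integral>\<^sup>+ \<omega>. (SUP k. unit_diam_sq k \<omega>) \<partial>M) \<le> ennreal (4 * ln 2 * real CARD('n))"
proof -
  have "incseq unit_diam_sq"
    unfolding unit_diam_sq_def
    by (intro incseq_SucI le_funI ennreal_leI power_mono seq_diam_nonneg)
      (rule seq_diam_dyadic_mono[where f = "\<lambda>t. W t _"])
  then have "(\<integral>\<^sup>+ \<omega>. (SUP k. unit_diam_sq k \<omega>) \<partial>M) = (SUP k. \<integral>\<^sup>+ \<omega>. unit_diam_sq k \<omega> \<partial>M)"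
    by (rule nn_integral_monotone_convergence_SUP) measurable
  also have "\<dots> \<le> ennreal (4 * ln 2 * real CARD('n))"
  proof (rule SUP_least)
    fix k
    have m: "(\<lambda>\<omega>. ennreal ((seq_diam (\<lambda>j. W (real j * (1 / 2 ^ k)) \<omega> $ i) (2 ^ k))\<^sup>2)) \<in> borel_measurable M" for i
      by (intro measurable_compose[OF _ measurable_ennreal] borel_measurable_power borel_measurable_seq_diam
          std_brownian_motion_1d_measurable[OF coordinate_brownian_motion[OF BM]]) simp
    have "(\<integral>\<^sup>+ \<omega>. unit_diam_sq k \<omega> \<partial>M)
      \<le> (\<integral>\<^sup>+ \<omega>. (\<Sum>i\<in>UNIV. ennreal ((seq_diam (\<lambda>j. W (real j * (1 / 2 ^ k)) \<omega> $ i) (2 ^ k))\<^sup>2)) \<partial>M)"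
      unfolding unit_diam_sq_def
      by (intro nn_integral_mono) (simp add: ennreal_leI seq_diam_sq_le_sum_components)
    also have "\<dots> = (\<Sum>i\<in>(UNIV::'n set). \<integral>\<^sup>+ \<omega>. ennreal ((seq_diam (\<lambda>j. W (real j * (1 / 2 ^ k)) \<omega> $ i) (2 ^ k))\<^sup>2) \<partial>M)"
      by (rule nn_integral_sum) (rule m)
    also have "\<dots> \<le> (\<Sum>i\<in>(UNIV::'n set). ennreal (4 * ln 2))"
    proof (rule sum_mono)
      fix i
      have "(\<integral>\<^sup>+ \<omega>. ennreal ((seq_diam (\<lambda>j. W (real j * (1 / 2 ^ k)) \<omega> $ i) (2 ^ k))\<^sup>2) \<partial>M)
        = ennreal (1 / 2 ^ k) * mean_sq_range (2 ^ k)"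
        by (rule nn_integral_sq_range_grid[OF coordinate_brownian_motion[OF BM]]) auto
      also have "\<dots> \<le> ennreal (1 / 2 ^ k) * ennreal (4 * ln 2 * real (2 ^ k))"
        by (intro mult_left_mono mean_sq_range_le[OF coordinate_brownian_motion[OF BM, of i]]) auto
      also have "\<dots> = ennreal (1 / 2 ^ k * (4 * ln 2 * real (2 ^ k)))"
        by (rule ennreal_mult'[symmetric]) simp
      also have "1 / 2 ^ k * (4 * ln 2 * real (2 ^ k)) = 4 * ln 2" by simp
      finally show "(\<integral>\<^sup>+ \<omega>. ennreal ((seq_diam (\<lambda>j. W (real j * (1 / 2 ^ k)) \<omega> $ i) (2 ^ k))\<^sup>2) \<partial>M)
        \<le> ennreal (4 * ln 2)" .
    qed
    also have "\<dots> = ennreal (4 * ln 2 * real CARD('n))"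
      by (simp add: ennreal_mult'' ennreal_of_nat_eq_real_of_nat mult.commute)
    finally show "(\<integral>\<^sup>+ \<omega>. unit_diam_sq k \<omega> \<partial>M) \<le> ennreal (4 * ln 2 * real CARD('n))" .
  qed
  finally show ?thesis .
qed

text \<open>Brownian scaling: on the grid with \<open>2 ^ k\<close> steps the diameter up to time \<open>t\<close> is \<open>sqrt t\<close> times the diameter up to time \<open>1\<close> in
  law, for each \<open>k\<close>. The events shrink as \<open>k\<close> grows, so the probability of their intersection is the limit of their probabilities.\<close>
lemma dyadic_diam_probability_ge:
  assumes t: "0 < t"
  shows "(\<integral>\<^sup>+ \<omega>. of_bool (ennreal t * (SUP k. unit_diam_sq k \<omega>) \<le> 1) \<partial>M)
    \<le> (\<integral>\<^sup>+ \<omega>. of_bool (\<forall>k. dyadic_diam_le W t k \<omega>) \<partial>M)"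
proof -
  have meas: "Measurable.pred M (dyadic_diam_le W t k)" for k
    unfolding dyadic_diam_le_def[abs_def]
    using borel_measurable_grid_diam[of "t / 2 ^ k" "2 ^ k"] t by simp
  then have meas' [measurable]: "(\<lambda>\<omega>. of_bool (dyadic_diam_le W t k \<omega>) :: ennreal) \<in> borel_measurable M" for k
    by measurable
  have scale: "(\<integral>\<^sup>+ \<omega>. of_bool (dyadic_diam_le W t k \<omega>) \<partial>M)
    = (\<integral>\<^sup>+ \<omega>. of_bool (ennreal t * unit_diam_sq k \<omega> \<le> 1) \<partial>M)" for k
  proof -
    note law = nn_integral_seq_diam_grid[OF distr_vector_grid_increments[OF BM] sets_std_gaussian_vec _
        std_brownian_motion_measurable[OF BM]]
    have "(\<integral>\<^sup>+ \<omega>. of_bool (dyadic_diam_le W t k \<omega>) \<partial>M)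
      = (\<integral>\<^sup>+ x. of_bool (sqrt (t / 2 ^ k) * seq_diam (walk x) (2 ^ k) \<le> 1)
          \<partial>PiM {..<2 ^ k} (\<lambda>_. std_gaussian_vec :: (real ^ 'n) measure))"
      unfolding dyadic_diam_le_def using t
      by (subst law[where h = "\<lambda>r. of_bool (r \<le> 1)"]) auto
    also have "\<dots> = (\<integral>\<^sup>+ x. of_bool (sqrt t * (sqrt (1 / 2 ^ k) * seq_diam (walk x) (2 ^ k)) \<le> 1)
          \<partial>PiM {..<2 ^ k} (\<lambda>_. std_gaussian_vec :: (real ^ 'n) measure))"
      by (simp add: real_sqrt_divide)
    also have "\<dots> = (\<integral>\<^sup>+ \<omega>. of_bool (sqrt t * seq_diam (\<lambda>j. W (real j * (1 / 2 ^ k)) \<omega>) (2 ^ k) \<le> 1) \<partial>M)"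
      by (subst law[where h = "\<lambda>r. of_bool (sqrt t * r \<le> 1)"]) auto
    also have "\<dots> = (\<integral>\<^sup>+ \<omega>. of_bool (ennreal t * unit_diam_sq k \<omega> \<le> 1) \<partial>M)"
    proof -
      have "sqrt t * r \<le> 1 \<longleftrightarrow> ennreal t * ennreal (r\<^sup>2) \<le> 1" if "0 \<le> r" for r
      proof -
        have "ennreal t * ennreal (r\<^sup>2) \<le> 1 \<longleftrightarrow> (sqrt t * r)\<^sup>2 \<le> 1"
          using t by (simp add: ennreal_mult'[symmetric] ennreal_le_1 power_mult_distrib)
        also have "\<dots> \<longleftrightarrow> sqrt t * r \<le> 1"
          using t that by (simp add: abs_square_le_1)
        finally show ?thesis by simp
      qed
      then show ?thesis by (simp add: unit_diam_sq_def)
    qed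
    finally show ?thesis .
  qed
  have dec: "decseq (\<lambda>k \<omega>. of_bool (dyadic_diam_le W t k \<omega>) :: ennreal)"
  proof (intro decseq_SucI le_funI)
    fix k \<omega>
    have "dyadic_diam_le W t (Suc k) \<omega> \<Longrightarrow> dyadic_diam_le W t k \<omega>"
      unfolding dyadic_diam_le_def using seq_diam_dyadic_mono[of "\<lambda>s. W s \<omega>" t k] by linarith
    then show "(of_bool (dyadic_diam_le W t (Suc k) \<omega>) :: ennreal) \<le> of_bool (dyadic_diam_le W t k \<omega>)"
      by auto
  qed
  have "(\<integral>\<^sup>+ \<omega>. of_bool (ennreal t * (SUP k. unit_diam_sq k \<omega>) \<le> 1) \<partial>M)
    \<le> (INF k. \<integral>\<^sup>+ \<omega>. of_bool (dyadic_diam_le W t k \<omega>) \<partial>M)"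
    unfolding scale
  proof (intro INF_greatest nn_integral_mono)
    fix k \<omega>
    have "ennreal t * unit_diam_sq k \<omega> \<le> ennreal t * (SUP k. unit_diam_sq k \<omega>)"
      by (intro mult_left_mono SUP_upper) auto
    then show "of_bool (ennreal t * (SUP k. unit_diam_sq k \<omega>) \<le> 1)
      \<le> (of_bool (ennreal t * unit_diam_sq k \<omega> \<le> 1) :: ennreal)"
      by (auto dest: order_trans)
  qed
  also have "\<dots> = (\<integral>\<^sup>+ \<omega>. (INF k. of_bool (dyadic_diam_le W t k \<omega>)) \<partial>M)"
  proof (rule nn_integral_monotone_convergence_INF_decseq[OF dec meas', symmetric])
    have "(\<integral>\<^sup>+ \<omega>. of_bool (dyadic_diam_le W t 0 \<omega>) \<partial>M) \<le> (\<integral>\<^sup>+ \<omega>. 1 \<partial>M)"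
      by (intro nn_integral_mono) auto
    also have "\<dots> < \<infinity>" by (simp add: emeasure_space_1)
    finally show "(\<integral>\<^sup>+ \<omega>. of_bool (dyadic_diam_le W t 0 \<omega>) \<partial>M) < \<infinity>" .
  qed
  also have "(\<lambda>\<omega>. INF k. of_bool (dyadic_diam_le W t k \<omega>)) = (\<lambda>\<omega>. of_bool (\<forall>k. dyadic_diam_le W t k \<omega>) :: ennreal)"
  proof
    fix \<omega>
    show "(INF k. of_bool (dyadic_diam_le W t k \<omega>)) = (of_bool (\<forall>k. dyadic_diam_le W t k \<omega>) :: ennreal)"
    proof (cases "\<forall>k. dyadic_diam_le W t k \<omega>")
      case False
      then obtain k where "\<not> dyadic_diam_le W t k \<omega>" by blast
      then have "(INF k. of_bool (dyadic_diam_le W t k \<omega>)) \<le> (0 :: ennreal)"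
        by (intro INF_lower2[of k]) auto
      then show ?thesis using False by simp
    qed simp
  qed
  finally show ?thesis .
qed

text \<open>Integrating \<open>two_over_le_grid_sum\<close> with \<open>c = 4 ln 2 * n\<close>, the bound for the mean of \<open>\<Delta>\<close>, leaves \<open>1 / c\<close> up to the mesh \<open>d\<close>.\<close>
lemma inverse_diameter_lower:
  "ennreal (1 / (4 * ln 2 * real CARD('n))) \<le> (\<integral>\<^sup>+ \<omega>. inverse_diameter W 1 \<omega> \<partial>M)"
proof (rule ennreal_le_epsilon)
  fix d :: real assume d: "0 < d"
  define c where "c = 4 * ln 2 * real CARD('n)"
  have c: "0 < c" by (simp add: c_def)
  define \<Delta> where "\<Delta> \<omega> = (SUP k. unit_diam_sq k \<omega>)" for \<omega>
  have [measurable]: "\<Delta> \<in> borel_measurable M" unfolding \<Delta>_def by measurable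
  obtain m where m: "2 / c < real m * d" using ex_less_of_nat_mult[OF d] by blast
  have dy [measurable]: "Measurable.pred M (\<lambda>\<omega>. \<forall>k. dyadic_diam_le W (real j * d) k \<omega>)" for j
  proof -
    have "Measurable.pred M (dyadic_diam_le W (real j * d) k)" for k
      unfolding dyadic_diam_le_def[abs_def]
      using borel_measurable_grid_diam[of "real j * d / 2 ^ k" "2 ^ k"] d by simp
    then show ?thesis by (rule pred_intros_countable)
  qed
  have "ennreal (2 / c) = (\<integral>\<^sup>+ \<omega>. ennreal (2 / c) \<partial>M)" by (simp add: emeasure_space_1)
  also have "\<dots> \<le> (\<integral>\<^sup>+ \<omega>. (\<Sum>j\<in>{1..m}. ennreal d * of_bool (ennreal (real j * d) * \<Delta> \<omega> \<le> 1))
      + ennreal (1 / c\<^sup>2) * \<Delta> \<omega> + ennreal d \<partial>M)"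
    using m by (intro nn_integral_mono two_over_le_grid_sum c d) simp
  also have "\<dots> = (\<Sum>j\<in>{1..m}. ennreal d * (\<integral>\<^sup>+ \<omega>. of_bool (ennreal (real j * d) * \<Delta> \<omega> \<le> 1) \<partial>M))
      + ennreal (1 / c\<^sup>2) * (\<integral>\<^sup>+ \<omega>. \<Delta> \<omega> \<partial>M) + ennreal d"
  proof -
    let ?S = "\<lambda>\<omega>. \<Sum>j\<in>{1..m}. ennreal d * of_bool (ennreal (real j * d) * \<Delta> \<omega> \<le> 1)"
    have "(\<integral>\<^sup>+ \<omega>. ?S \<omega> \<partial>M)
      = (\<Sum>j\<in>{1..m}. ennreal d * (\<integral>\<^sup>+ \<omega>. of_bool (ennreal (real j * d) * \<Delta> \<omega> \<le> 1) \<partial>M))"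
      by (subst nn_integral_sum, measurable, intro sum.cong refl nn_integral_cmult, measurable)
    moreover have "(\<integral>\<^sup>+ \<omega>. ennreal d \<partial>M) = ennreal d" by (simp add: emeasure_space_1)
    moreover have "(\<integral>\<^sup>+ \<omega>. ennreal (1 / c\<^sup>2) * \<Delta> \<omega> \<partial>M) = ennreal (1 / c\<^sup>2) * (\<integral>\<^sup>+ \<omega>. \<Delta> \<omega> \<partial>M)"
      by (rule nn_integral_cmult) measurable
    moreover have "(\<integral>\<^sup>+ \<omega>. ?S \<omega> + ennreal (1 / c\<^sup>2) * \<Delta> \<omega> + ennreal d \<partial>M)
      = (\<integral>\<^sup>+ \<omega>. ?S \<omega> + ennreal (1 / c\<^sup>2) * \<Delta> \<omega> \<partial>M) + (\<integral>\<^sup>+ \<omega>. ennreal d \<partial>M)"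
      by (rule nn_integral_add) measurable
    moreover have "(\<integral>\<^sup>+ \<omega>. ?S \<omega> + ennreal (1 / c\<^sup>2) * \<Delta> \<omega> \<partial>M)
      = (\<integral>\<^sup>+ \<omega>. ?S \<omega> \<partial>M) + (\<integral>\<^sup>+ \<omega>. ennreal (1 / c\<^sup>2) * \<Delta> \<omega> \<partial>M)"
      by (rule nn_integral_add) measurable
    ultimately show ?thesis by (simp only:)
  qed
  also have "\<dots> \<le> (\<Sum>j\<in>{1..m}. ennreal d * (\<integral>\<^sup>+ \<omega>. of_bool (\<forall>k. dyadic_diam_le W (real j * d) k \<omega>) \<partial>M))
      + ennreal (1 / c\<^sup>2) * ennreal c + ennreal d"
    unfolding \<Delta>_def
    by (intro add_mono sum_mono mult_left_mono dyadic_diam_probability_ge order_refl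
        mean_unit_diam_sq_le[folded c_def]) (use d in auto)
  also have "(\<Sum>j\<in>{1..m}. ennreal d * (\<integral>\<^sup>+ \<omega>. of_bool (\<forall>k. dyadic_diam_le W (real j * d) k \<omega>) \<partial>M))
      = (\<integral>\<^sup>+ \<omega>. (\<Sum>j\<in>{1..m}. ennreal d * of_bool (\<forall>k. dyadic_diam_le W (real j * d) k \<omega>)) \<partial>M)"
    by (subst nn_integral_sum) (auto intro!: sum.cong nn_integral_cmult[symmetric])
  also have "\<dots> \<le> (\<integral>\<^sup>+ \<omega>. inverse_diameter W 1 \<omega> \<partial>M)"
    by (intro nn_integral_mono_AE eventually_mono[OF AE_continuous_paths]
        sum_dyadic_diam_le_inverse_diameter d)
  finally have le: "ennreal (2 / c) \<le> (\<integral>\<^sup>+ \<omega>. inverse_diameter W 1 \<omega> \<partial>M) + ennreal (1 / c\<^sup>2) * ennreal c + ennreal d"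
    by (simp add: add_right_mono)
  have "ennreal (1 / c\<^sup>2) * ennreal c = ennreal (1 / c)"
    using c by (simp add: ennreal_mult'[symmetric] power2_eq_square)
  moreover have "ennreal (2 / c) = ennreal (1 / c) + ennreal (1 / c)"
    using c by (simp flip: ennreal_plus)
  ultimately have "ennreal (1 / c) + ennreal (1 / c) \<le> ennreal (1 / c) + ((\<integral>\<^sup>+ \<omega>. inverse_diameter W 1 \<omega> \<partial>M) + ennreal d)"
    using le by (simp add: add_ac)
  then show "ennreal (1 / (4 * ln 2 * real CARD('n))) \<le> (\<integral>\<^sup>+ \<omega>. inverse_diameter W 1 \<omega> \<partial>M) + ennreal d"
    unfolding c_def[symmetric] by (subst (asm) ennreal_add_left_cancel_le) auto
qed

end

theorem theorem4:
  fixes M :: "'w measure" and W :: "real \<Rightarrow> 'w \<Rightarrow> real ^ 'n"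
  assumes "std_brownian_motion M W"
  shows "ennreal (1 / (4 * ln 2) * (1 / real CARD('n))) \<le> (\<integral>\<^sup>+ \<omega>. inverse_diameter W 1 \<omega> \<partial>M) \<and>
         (\<integral>\<^sup>+ \<omega>. inverse_diameter W 1 \<omega> \<partial>M) \<le> ennreal (1 / real CARD('n))"
proof
  have "1 / (4 * ln 2) * (1 / real CARD('n)) = 1 / (4 * ln 2 * real CARD('n))" by simp
  then show "ennreal (1 / (4 * ln 2) * (1 / real CARD('n))) \<le> (\<integral>\<^sup>+ \<omega>. inverse_diameter W 1 \<omega> \<partial>M)"
    using inverse_diameter_lower[OF assms] by (simp only:)
  show "(\<integral>\<^sup>+ \<omega>. inverse_diameter W 1 \<omega> \<partial>M) \<le> ennreal (1 / real CARD('n))"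
    by (rule inverse_diameter_upper[OF assms])
qed

end
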